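(* Let $n,m\ge 1$ be integers and let $a,b$ be real numbers with $a\neq 0$ and $b\neq 0$. Suppose that the Fubini-Study spaces $\mathbf{F}(n,b)$ and $\mathbf{F}(m,a)$ are relatives. Then $ab>0$ and $a/b\in\mathbb{Q}$.
   Context: For a non-zero real number $b$, the Fubini-Study space $\mathbf{F}(n,b)$ is the complex space form whose Kähler potential is locally given by $\frac1b\log(1+b|Z|^2)$, where $Z=(z_1,\dots,z_n)$ and $|Z|^2=\sum_{i=1}^n|z_i|^2$; i.e. the Kähler form is $\sqrt{-1}\,\partial\bar\partial$ of this function. If $b>0$ it is the complex projective space $\mathbb{CP}^n$ (with $Z$ suitable affine coordinates); if $b<0$ it is the complex hyperbolic space, realized as the ball $\{|Z|^2<-1/b\}\subset\mathbb{C}^n$. Two Kähler manifolds are called relatives when they share a common positive-dimensional Kähler submanifold, i.e. a positive-dimensional complex submanifold of one of them endowed with the induced metric is biholomorphically isometric to a complex submanifold of the other endowed with the induced metric. *)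

theory Defs
  imports "HOL-Analysis.Analysis"
begin

text \<open>A local chart is recorded through its inverse, the injective local parametrization
  \<open>param\<close> of a subset of the manifold. The parameter domain \<open>pdom\<close> is a relatively open
  subset of the complex-linear subspace \<open>model\<close> of \<open>complex^'n\<close>. For an \<open>n\<close>-dimensional
  manifold this subspace is everything; a smaller one is used for charts of submanifolds, whose
  dimension is then not tied to a type. The tangent space in the chart is \<open>model\<close>, and
  \<open>herm z u v\<close> is the Hermitian metric, the sum of the \<open>h\<^sub>i\<^sub>j u\<^sub>i (cnj v\<^sub>j)\<close>, whose Kaehler form is
  the sum of the \<open>\<i> h\<^sub>i\<^sub>j dz\<^sub>i \<and> d(cnj z\<^sub>j)\<close>.\<close>

record ('p, 'n::finite) hchart =
  model :: "(complex^'n) set"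
  pdom :: "(complex^'n) set"
  param :: "complex^'n \<Rightarrow> 'p"
  herm :: "complex^'n \<Rightarrow> complex^'n \<Rightarrow> complex^'n \<Rightarrow> complex"

type_synonym ('p, 'n) atlas = "('p, 'n) hchart set"

definition cimage :: "('p, 'n::finite) hchart \<Rightarrow> 'p set" where
  "cimage c = param c ` pdom c"

definition coords :: "('p, 'n::finite) hchart \<Rightarrow> 'p \<Rightarrow> complex^'n" where
  "coords c = inv_into (pdom c) (param c)"

definition points :: "('p, 'n::finite) atlas \<Rightarrow> 'p set" where
  "points M = (\<Union>c\<in>M. cimage c)"

text \<open>When \<open>A\<close> is relatively open in a complex subspace, \<open>D\<close> is determined on that subspace.\<close>

definition has_cderiv ::
  "(complex^'n \<Rightarrow> complex^'m) \<Rightarrow> (complex^'n \<Rightarrow> complex^'m) \<Rightarrow> complex^'n \<Rightarrow> (complex^'n) set \<Rightarrow> bool"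
  where "has_cderiv f D z A \<longleftrightarrow>
    (f has_derivative D) (at z within A) \<and> Vector_Spaces.linear (*s) (*s) D"

definition hol_on :: "(complex^'n \<Rightarrow> complex^'m) \<Rightarrow> (complex^'n) set \<Rightarrow> bool" where
  "hol_on f A \<longleftrightarrow> (\<forall>z\<in>A. \<exists>D. has_cderiv f D z A)"

definition local_dom :: "('p \<Rightarrow> 'q) \<Rightarrow> ('p, 'n::finite) hchart \<Rightarrow> ('q, 'm::finite) hchart \<Rightarrow> (complex^'n) set"
  where "local_dom f c d = {z \<in> pdom c. f (param c z) \<in> cimage d}"

definition local_rep ::
  "('p \<Rightarrow> 'q) \<Rightarrow> ('p, 'n::finite) hchart \<Rightarrow> ('q, 'm::finite) hchart \<Rightarrow> complex^'n \<Rightarrow> complex^'m"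
  where "local_rep f c d = (\<lambda>z. coords d (f (param c z)))"

definition holomorphic_map :: "('p, 'n::finite) atlas \<Rightarrow> ('q, 'm::finite) atlas \<Rightarrow> ('p \<Rightarrow> 'q) \<Rightarrow> bool"
  where "holomorphic_map M N f \<longleftrightarrow> f ` points M \<subseteq> points N \<and>
    (\<forall>c\<in>M. \<forall>d\<in>N. openin (top_of_set (model c)) (local_dom f c d) \<and>
       hol_on (local_rep f c d) (local_dom f c d))"

definition preserves_metric :: "('p, 'n::finite) atlas \<Rightarrow> ('q, 'm::finite) atlas \<Rightarrow> ('p \<Rightarrow> 'q) \<Rightarrow> bool"
  where "preserves_metric M N f \<longleftrightarrow>
    (\<forall>c\<in>M. \<forall>d\<in>N. \<forall>z\<in>local_dom f c d. \<forall>D. has_cderiv (local_rep f c d) D z (local_dom f c d) \<longrightarrow>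
      (\<forall>u\<in>model c. \<forall>v\<in>model c. herm d (local_rep f c d z) (D u) (D v) = herm c z u v))"

definition biholomorphically_isometric :: "('p, 'n::finite) atlas \<Rightarrow> ('q, 'm::finite) atlas \<Rightarrow> bool"
  where "biholomorphically_isometric M N \<longleftrightarrow> (\<exists>f. bij_betw f (points M) (points N) \<and>
    holomorphic_map M N f \<and> holomorphic_map N M (inv_into (points M) f) \<and> preserves_metric M N f)"

definition biholomorphism_onto_image ::
  "(complex^'n) set \<Rightarrow> (complex^'n \<Rightarrow> complex^'n) \<Rightarrow> (complex^'n) set \<Rightarrow> bool"
  where "biholomorphism_onto_image E \<beta> W \<longleftrightarrow>
    openin (top_of_set E) W \<and> openin (top_of_set E) (\<beta> ` W) \<and> inj_on \<beta> W \<and>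
    hol_on \<beta> W \<and> hol_on (inv_into W \<beta>) (\<beta> ` W)"

text \<open>\<open>adapted M k S c \<beta> W L\<close>: the holomorphic change of coordinates \<open>\<beta>\<close> turns the chart \<open>c\<close> of \<open>M\<close>
  into one, \<open>param c \<circ> \<beta>\<close> on \<open>W\<close>, in which \<open>S\<close> is the \<open>k\<close>-dimensional linear slice \<open>L\<close>.\<close>

definition adapted ::
  "('p, 'n::finite) atlas \<Rightarrow> nat \<Rightarrow> 'p set \<Rightarrow> ('p, 'n) hchart \<Rightarrow> (complex^'n \<Rightarrow> complex^'n) \<Rightarrow>
    (complex^'n) set \<Rightarrow> (complex^'n) set \<Rightarrow> bool"
  where "adapted M k S c \<beta> W L \<longleftrightarrow>
    c \<in> M \<and> biholomorphism_onto_image (model c) \<beta> W \<and> \<beta> ` W \<subseteq> pdom c \<and>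
    vec.subspace L \<and> L \<subseteq> model c \<and> vec.dim L = k \<and>
    (\<forall>w\<in>W. param c (\<beta> w) \<in> S \<longleftrightarrow> w \<in> L)"

text \<open>The slice chart carries the restriction to \<open>L\<close> of the coordinates and of the pulled-back metric. The
  derivative of \<open>\<beta>\<close> is unique on \<open>model c\<close>, which contains \<open>L\<close>.\<close>

definition slice_chart ::
  "('p, 'n::finite) hchart \<Rightarrow> (complex^'n \<Rightarrow> complex^'n) \<Rightarrow> (complex^'n) set \<Rightarrow> (complex^'n) set \<Rightarrow>
    ('p, 'n) hchart"
  where "slice_chart c \<beta> W L =
    \<lparr>model = L, pdom = W \<inter> L, param = param c \<circ> \<beta>,
     herm = (\<lambda>w u v. let D = (SOME D. has_cderiv \<beta> D w W) in herm c (\<beta> w) (D u) (D v))\<rparr>"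

definition induced :: "('p, 'n::finite) atlas \<Rightarrow> nat \<Rightarrow> 'p set \<Rightarrow> ('p, 'n) atlas" where
  "induced M k S = {slice_chart c \<beta> W L | c \<beta> W L. adapted M k S c \<beta> W L}"

text \<open>Non-empty embedded submanifolds, of pure dimension \<open>k\<close> but not necessarily closed or
  connected.\<close>

definition complex_submanifold :: "('p, 'n::finite) atlas \<Rightarrow> nat \<Rightarrow> 'p set \<Rightarrow> bool" where
  "complex_submanifold M k S \<longleftrightarrow> S \<noteq> {} \<and> S \<subseteq> points M \<and>
    (\<forall>p\<in>S. \<exists>c \<beta> W L. adapted M k S c \<beta> W L \<and> p \<in> (param c \<circ> \<beta>) ` W)"

definition relatives :: "('p, 'n::finite) atlas \<Rightarrow> ('q, 'm::finite) atlas \<Rightarrow> bool" where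
  "relatives M N \<longleftrightarrow> (\<exists>k\<ge>1. \<exists>S T. complex_submanifold M k S \<and> complex_submanifold N k T \<and>
     biholomorphically_isometric (induced M k S) (induced N k T))"

definition wirtinger :: "'n \<Rightarrow> (complex^'n \<Rightarrow> complex) \<Rightarrow> complex^'n \<Rightarrow> complex" where
  "wirtinger i f z = (frechet_derivative f (at z) (axis i 1)
     - \<i> * frechet_derivative f (at z) (axis i \<i>)) / 2"

definition wirtinger_bar :: "'n \<Rightarrow> (complex^'n \<Rightarrow> complex) \<Rightarrow> complex^'n \<Rightarrow> complex" where
  "wirtinger_bar i f z = (frechet_derivative f (at z) (axis i 1)
     + \<i> * frechet_derivative f (at z) (axis i \<i>)) / 2"

text \<open>The Hermitian metric with Kaehler potential \<open>\<phi>\<close>, that is, whose Kaehler form is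
  \<open>\<i>\<close> times del delbar \<open>\<phi>\<close>.\<close>

definition potential_metric ::
  "(complex^'n \<Rightarrow> real) \<Rightarrow> complex^'n \<Rightarrow> complex^'n \<Rightarrow> complex^'n \<Rightarrow> complex"
  where "potential_metric \<phi> z u v =
    (\<Sum>i\<in>UNIV. \<Sum>j\<in>UNIV.
       wirtinger i (wirtinger_bar j (\<lambda>x. complex_of_real (\<phi> x))) z * (u $ i) * cnj (v $ j))"

text \<open>Points of projective \<open>n\<close>-space are the lines spanned by the non-zero vectors of
  \<open>complex^('n option)\<close>, the homogeneous coordinate \<open>z\<^sub>0\<close> having index \<open>None\<close>.
  \<open>affine_lift j w\<close> is the vector whose \<open>j\<close>-th homogeneous coordinate is 1 and whose other
  coordinates are those of \<open>w\<close>, \<open>z\<^sub>0\<close> taking the place that \<open>j\<close> leaves vacant.\<close>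

type_synonym 'n homogeneous = "(complex, 'n option) vec"

definition affine_lift :: "'n option \<Rightarrow> complex^'n::finite \<Rightarrow> 'n homogeneous" where
  "affine_lift j w = (\<chi> l. if l = j then 1
     else (case l of None \<Rightarrow> w $ the j | Some i \<Rightarrow> w $ i))"

definition affine_point :: "'n option \<Rightarrow> complex^'n::finite \<Rightarrow> 'n homogeneous set" where
  "affine_point j w = vec.span {affine_lift j w}"

text \<open>On the affine piece \<open>v $ j = 1\<close>; the homogeneous coordinates other than \<open>z\<^sub>0\<close> are the
  customary unitary ones divided by \<open>sqrt b\<close>. For \<open>j = None\<close> this is \<open>ln (1 + b * (norm Z)\<^sup>2) / b\<close>; on
  overlaps, potentials differ by the pluriharmonic \<open>ln ((norm (v $ j))\<^sup>2) / b\<close>.\<close>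

definition projective_potential :: "real \<Rightarrow> 'n option \<Rightarrow> complex^'n::finite \<Rightarrow> real" where
  "projective_potential b j w =
    (let v = affine_lift j w
     in ln ((norm (v $ None))\<^sup>2 + b * (\<Sum>i\<in>UNIV. (norm (v $ Some i))\<^sup>2)) / b)"

lemma projective_potential_None: "projective_potential b None Z = ln (1 + b * (norm Z)\<^sup>2) / b"
  by (simp add: projective_potential_def affine_lift_def norm_vec_def L2_set_def sum_nonneg)

definition projective_chart :: "real \<Rightarrow> 'n::finite option \<Rightarrow> ('n homogeneous set, 'n) hchart" where
  "projective_chart b j = \<lparr>model = UNIV, pdom = UNIV, param = affine_point j,
     herm = potential_metric (projective_potential b j)\<rparr>"

text \<open>The ball of complex hyperbolic space; its point \<open>Z\<close> is recorded as the line of \<open>(1, Z)\<close>.\<close>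

definition ball_chart :: "real \<Rightarrow> ('n::finite homogeneous set, 'n) hchart" where
  "ball_chart b = \<lparr>model = UNIV, pdom = {Z. (norm Z)\<^sup>2 < - 1 / b}, param = affine_point None,
     herm = potential_metric (\<lambda>Z. ln (1 + b * (norm Z)\<^sup>2) / b)\<rparr>"

definition fubini_study :: "real \<Rightarrow> ('n::finite homogeneous set, 'n) atlas" where
  "fubini_study b = (if b > 0 then range (projective_chart b) else {ball_chart b})"

end

theory Submission
  imports Defs "HOL-Complex_Analysis.Complex_Analysis"
    "HOL-Computational_Algebra.Fundamental_Theorem_Algebra" "HOL-Library.Function_Algebras"
begin

text \<open>Restrict both metrics to a common disc, parametrized by curves \<open>V\<close> and \<open>U\<close> in homogeneous
  coordinates, and let \<open>H(z, w)\<close>, \<open>P(z, w)\<close> be the polarizations of the defining Hermitian forms along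
  them, normalized to be \<open>1\<close> for \<open>z = 0\<close> or \<open>w = 0\<close>. Equality of the metrics says \<open>P = H\<^sup>c\<close> with
  \<open>c = a / b\<close>, that is, \<open>c H\<^sub>w P = H P\<^sub>w\<close>; here \<open>H\<close> and \<open>P\<close> are finite sums of products
  \<open>F\<^sub>i(z) K\<^sub>i(w)\<close>. For fixed \<open>w\<close> this is an identity in the finitely generated algebra of the
  functions of \<open>z\<close>, so it survives when a character of that algebra replaces evaluation at \<open>z\<close>. By a
  Nullstellensatz argument some characters send a non-constant function to arbitrarily large values, and
  by Hurwitz's theorem the image of \<open>H\<close> under one of them has a zero \<open>w\<^sub>0\<close> in the disc. Comparing orders
  of vanishing at \<open>w\<^sub>0\<close> gives \<open>c\<close> as a quotient of natural numbers.\<close>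

text \<open>The obstacle is that the disc is only local. On it neither kernel vanishes, so
  \<open>H\<close> has a power with every real exponent and no single point \<open>z\<close> sees
  whether \<open>c\<close> is rational; the zero that would decide may lie where the curves cannot
  be continued. Characters are the substitute for such points: they assign to the functions of
  \<open>z\<close> values that need not be attained on the disc. This explains the form of the
  identity. It is stated with \<open>w\<close>-derivatives because it is then polynomial in the
  coefficient functions of \<open>z\<close>, without powers or logarithms, and a ring homomorphism
  can be applied to it. The normalization at \<open>w = 0\<close> is a relation \<open>1 = 1\<close>
  that every character preserves, so the transformed functions are not identically zero. In
  \<open>z\<close> only the algebra generated by the coefficients enters, while all complex analysis
  happens in \<open>w\<close>. The sign of \<open>ab\<close> needs no separate argument: a quotient
  of orders is non-negative, and \<open>c\<close> is not zero.\<close>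

no_notation fps_nth (infixl \<open>$\<close> 75)

section \<open>Characters of finitely generated function algebras\<close>

text \<open>The algebra consists of actual functions, not of residue classes of polynomials: every
  relation between the generators that holds pointwise is automatically a relation in it.\<close>

inductive_set gen_alg :: "('a \<Rightarrow> complex) set \<Rightarrow> ('a \<Rightarrow> complex) set" for G where
  const: "(\<lambda>x. c) \<in> gen_alg G"
| gen: "g \<in> G \<Longrightarrow> g \<in> gen_alg G"
| add: "f \<in> gen_alg G \<Longrightarrow> g \<in> gen_alg G \<Longrightarrow> (\<lambda>x. f x + g x) \<in> gen_alg G"
| mult: "f \<in> gen_alg G \<Longrightarrow> g \<in> gen_alg G \<Longrightarrow> (\<lambda>x. f x * g x) \<in> gen_alg G"

lemma gen_alg_sum: "(\<And>i. i \<in> I \<Longrightarrow> f i \<in> gen_alg G) \<Longrightarrow> (\<lambda>x. \<Sum>i\<in>I. f i x) \<in> gen_alg G"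
  by (induction I rule: infinite_finite_induct) (auto intro: gen_alg.intros)

lemma gen_alg_prod: "(\<And>i. i \<in> I \<Longrightarrow> f i \<in> gen_alg G) \<Longrightarrow> (\<lambda>x. \<Prod>i\<in>I. f i x) \<in> gen_alg G"
  by (induction I rule: infinite_finite_induct) (auto intro: gen_alg.intros)

lemma gen_alg_diff:
  assumes "f \<in> gen_alg G" "g \<in> gen_alg G" shows "(\<lambda>x. f x - g x) \<in> gen_alg G"
  using gen_alg.add[OF assms(1) gen_alg.mult[OF gen_alg.const[of "-1"] assms(2)]] by simp

lemma gen_alg_poly: "f \<in> gen_alg G \<Longrightarrow> (\<lambda>x. poly q (f x)) \<in> gen_alg G"
  by (induction q) (auto intro: gen_alg.intros)

interpretation cfun: vector_space "\<lambda>c (f :: 'a \<Rightarrow> complex) x. c * f x"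
  by unfold_locales (auto simp: fun_eq_iff algebra_simps)

section \<open>Countable dimension and linear dependence\<close>

text \<open>Indexing by lists turns multiplication into concatenation and reduces countability to
  that of lists over a countable set.\<close>

definition monomials :: "('a \<Rightarrow> complex) set \<Rightarrow> ('a \<Rightarrow> complex) set" where
  "monomials G = (\<lambda>gs x. \<Prod>g\<leftarrow>gs. g x) ` lists G"

lemma countable_monomials: "countable G \<Longrightarrow> countable (monomials G)"
  unfolding monomials_def by (intro countable_image countable_lists)

lemma span_monomials_mult:
  assumes "f \<in> cfun.span (monomials G)" "g \<in> cfun.span (monomials G)"
  shows "(\<lambda>x. f x * g x) \<in> cfun.span (monomials G)"
proof -
  have mono: "(\<lambda>x. p x * g x) \<in> cfun.span (monomials G)" if p: "p \<in> monomials G" for p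
    using assms(2)
  proof (induction rule: cfun.span_induct_alt)
    case base
    show ?case using cfun.span_zero by (simp add: zero_fun_def)
  next
    case (step c q y)
    have "(\<lambda>x. p x * q x) \<in> monomials G"
    proof -
      obtain ps qs where "ps \<in> lists G" "qs \<in> lists G" "p = (\<lambda>x. \<Prod>g\<leftarrow>ps. g x)" "q = (\<lambda>x. \<Prod>g\<leftarrow>qs. g x)"
        using p step(1) by (auto simp: monomials_def)
      then show ?thesis unfolding monomials_def by (intro image_eqI[of _ _ "ps @ qs"]) auto
    qed
    from cfun.span_add[OF cfun.span_scale[OF cfun.span_base[OF this], of c] step(2)]
    show ?case by (simp add: plus_fun_def algebra_simps)
  qed
  show ?thesis using assms(1)
  proof (induction rule: cfun.span_induct_alt)
    case base
    show ?case using cfun.span_zero by (simp add: zero_fun_def)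
  next
    case (step c q y)
    from cfun.span_add[OF cfun.span_scale[OF mono[OF step(1)], of c] step(2)]
    show ?case by (simp add: plus_fun_def algebra_simps)
  qed
qed

lemma gen_alg_subset_span: "gen_alg G \<subseteq> cfun.span (monomials G)"
proof
  fix f assume "f \<in> gen_alg G"
  then show "f \<in> cfun.span (monomials G)"
  proof induction
    case (const c)
    have "(\<lambda>x. 1) \<in> monomials G" unfolding monomials_def by (intro image_eqI[of _ _ "[]"]) auto
    from cfun.span_scale[OF cfun.span_base[OF this], of c] show ?case by simp
  next
    case (gen g)
    then have "g \<in> monomials G" unfolding monomials_def by (intro image_eqI[of _ _ "[g]"]) auto
    then show ?case by (rule cfun.span_base)
  next
    case (add f g)
    from cfun.span_add[OF add.IH] show ?case by (simp add: plus_fun_def)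
  next
    case (mult f g)
    then show ?case by (intro span_monomials_mult)
  qed
qed

text \<open>Pigeonhole: each \<open>h l\<close> lies in the span of a finite set of monomials, and
  there are only countably many such sets. Hence infinitely many \<open>h l\<close> share one finite
  set \<open>C\<close>, and \<open>card C + 1\<close> of them are dependent.\<close>

lemma uncountable_family_dependent:
  fixes h :: "'b \<Rightarrow> 'a \<Rightarrow> complex"
  assumes "countable G" "uncountable \<Lambda>" "\<And>l. l \<in> \<Lambda> \<Longrightarrow> h l \<in> gen_alg G"
  obtains L d l0 where "finite L" "L \<subseteq> \<Lambda>" "l0 \<in> L" "d l0 \<noteq> 0" "\<forall>x. (\<Sum>l\<in>L. d l * h l x) = 0"
proof -
  have "\<exists>B. finite B \<and> B \<subseteq> monomials G \<and> h l \<in> cfun.span B" if "l \<in> \<Lambda>" for l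
  proof -
    have "h l \<in> cfun.span (monomials G)" using gen_alg_subset_span assms(3)[OF that] by blast
    then obtain t r where tr: "finite t" "t \<subseteq> monomials G" "h l = (\<Sum>a\<in>t. (\<lambda>x. r a * a x))"
      unfolding cfun.span_explicit by blast
    then show ?thesis
      by (intro exI[of _ t]) (auto intro!: cfun.span_sum cfun.span_scale intro: cfun.span_base)
  qed
  then obtain B where B: "\<And>l. l \<in> \<Lambda> \<Longrightarrow> finite (B l) \<and> B l \<subseteq> monomials G \<and> h l \<in> cfun.span (B l)"
    by metis
  have "\<exists>C. infinite {l \<in> \<Lambda>. B l = C}"
  proof (rule ccontr)
    assume "\<not> ?thesis"
    then have fin: "finite {l \<in> \<Lambda>. B l = C}" for C by blast
    have "countable {C. finite C \<and> C \<subseteq> monomials G}"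
      using countable_monomials[OF assms(1)] by (rule countable_Collect_finite_subset)
    then have "countable (\<Union>C\<in>{C. finite C \<and> C \<subseteq> monomials G}. {l \<in> \<Lambda>. B l = C})"
      using fin by (intro countable_UN) (auto intro: countable_finite)
    moreover have "\<Lambda> \<subseteq> (\<Union>C\<in>{C. finite C \<and> C \<subseteq> monomials G}. {l \<in> \<Lambda>. B l = C})"
    proof
      fix l assume "l \<in> \<Lambda>"
      then show "l \<in> (\<Union>C\<in>{C. finite C \<and> C \<subseteq> monomials G}. {l \<in> \<Lambda>. B l = C})"
        using B[of l] by (intro UN_I[of "B l"]) simp_all
    qed
    ultimately show False using assms(2) countable_subset by blast
  qed
  then obtain C where "infinite {l \<in> \<Lambda>. B l = C}" by blast
  then obtain L where L: "finite L" "card L = Suc (card C)" "L \<subseteq> {l \<in> \<Lambda>. B l = C}"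
    using infinite_arbitrarily_large by blast
  have Lne: "L \<noteq> {}" using L by auto
  then have C: "finite C" using L B by blast
  show thesis
  \<comment> \<open>Independence is a notion for sets of functions, not for families. If two members
    of the family coincide, their difference is already the relation sought.\<close>
  proof (cases "inj_on h L")
    case True
    have "\<not> cfun.independent (h ` L)"
    proof
      assume "cfun.independent (h ` L)"
      then have "card (h ` L) \<le> card C"
        using cfun.independent_span_bound[OF C, of "h ` L"] L(3) B by blast
      then show False using L(2) card_image[OF True] by simp
    qed
    then obtain u v where uv: "(\<Sum>v\<in>h ` L. (\<lambda>x. u v * v x)) = 0" "v \<in> h ` L" "u v \<noteq> 0"
      using cfun.dependent_finite[of "h ` L"] L(1) by auto
    then obtain l0 where l0: "l0 \<in> L" "v = h l0" by blast
    have "(\<Sum>l\<in>L. u (h l) * h l x) = 0" for x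
    proof -
      have "(\<Sum>l\<in>L. u (h l) * h l x) = (\<Sum>v\<in>h ` L. u v * v x)"
        by (simp add: sum.reindex[OF True])
      also have "\<dots> = (\<Sum>v\<in>h ` L. (\<lambda>x. u v * v x)) x"
        by (induction rule: infinite_finite_induct) auto
      finally show ?thesis by (simp add: uv)
    qed
    then show thesis using that[of L l0 "\<lambda>l. u (h l)"] L l0 uv by auto
  next
    case False
    then obtain k l where kl: "k \<in> L" "l \<in> L" "k \<noteq> l" "h k = h l" by (auto simp: inj_on_def)
    then show thesis
      using that[of "{k,l}" k "\<lambda>i. if i = k then 1 else -1"] L by auto
  qed
qed

section \<open>Ideals, maximal ideals and their residue fields\<close>

definition alg_ideal :: "('a \<Rightarrow> complex) set \<Rightarrow> ('a \<Rightarrow> complex) set \<Rightarrow> bool" where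
  "alg_ideal A I \<longleftrightarrow> I \<subseteq> A \<and> (\<lambda>x. 0) \<in> I \<and> (\<forall>f\<in>I. \<forall>g\<in>I. (\<lambda>x. f x + g x) \<in> I) \<and>
     (\<forall>f\<in>A. \<forall>g\<in>I. (\<lambda>x. f x * g x) \<in> I)"

lemma alg_idealD:
  assumes "alg_ideal A I"
  shows "f \<in> I \<Longrightarrow> f \<in> A" "(\<lambda>x. 0) \<in> I" "f \<in> I \<Longrightarrow> g \<in> I \<Longrightarrow> (\<lambda>x. f x + g x) \<in> I"
    "f \<in> A \<Longrightarrow> g \<in> I \<Longrightarrow> (\<lambda>x. f x * g x) \<in> I"
  using assms unfolding alg_ideal_def by blast+

lemma alg_ideal_sum:
  assumes "alg_ideal A I" "\<And>i. i \<in> L \<Longrightarrow> f i \<in> I" shows "(\<lambda>x. \<Sum>i\<in>L. f i x) \<in> I"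
  using assms(2)
proof (induction L rule: infinite_finite_induct)
  case (insert i L)
  then have "(\<lambda>x. f i x + (\<Sum>i\<in>L. f i x)) \<in> I" by (intro alg_idealD(3)[OF assms(1)]) auto
  then show ?case using insert.hyps by simp
qed (simp_all add: alg_idealD(2)[OF assms(1)])

text \<open>The argument behind Amitsur's proof of the Nullstellensatz over an uncountable field:
  uncountably many inverses of \<open>g - l\<close> are linearly dependent, and clearing denominators in a
  linear relation between them leaves a polynomial relation for \<open>g\<close>.\<close>

lemma uncountably_many_inverses_imp_algebraic:
  assumes "countable G" "alg_ideal (gen_alg G) I" "g \<in> gen_alg G" "uncountable \<Lambda>"
    and "\<And>l. l \<in> \<Lambda> \<Longrightarrow> \<exists>h\<in>gen_alg G. (\<lambda>x. h x * (g x - l) - 1) \<in> I"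
  obtains q where "q \<noteq> 0" "(\<lambda>x. poly q (g x)) \<in> I"
proof -
  obtain h where h: "\<And>l. l \<in> \<Lambda> \<Longrightarrow> h l \<in> gen_alg G"
      "\<And>l. l \<in> \<Lambda> \<Longrightarrow> (\<lambda>x. h l x * (g x - l) - 1) \<in> I"
    using assms(5) by metis
  obtain L d l0 where L: "finite L" "L \<subseteq> \<Lambda>" "l0 \<in> L" "d l0 \<noteq> 0"
      and rel: "\<forall>x. (\<Sum>l\<in>L. d l * h l x) = 0"
    by (rule uncountable_family_dependent[OF assms(1,4) h(1)]) blast
  \<comment> \<open>This is the relation between the \<open>h l\<close> with \<open>h l\<close>
    replaced by \<open>1 / (y - l)\<close>, multiplied by the product of all
    \<open>y - k\<close>.\<close>
  define q where "q = (\<Sum>l\<in>L. smult (d l) (\<Prod>k\<in>L - {l}. [:-k, 1:]))"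
  have polyq: "poly q y = (\<Sum>l\<in>L. d l * (\<Prod>k\<in>L - {l}. y - k))" for y
    by (simp add: q_def poly_sum poly_prod)
  \<comment> \<open>Every summand with \<open>l \<noteq> l0\<close> contains the factor
    \<open>l0 - l0\<close>, so evaluation at \<open>l0\<close> isolates the non-zero coefficient
    \<open>d l0\<close>.\<close>
  have "poly q l0 = (\<Sum>l\<in>L. if l = l0 then d l0 * (\<Prod>k\<in>L - {l0}. l0 - k) else 0)"
    unfolding polyq using L(1,3) by (intro sum.cong) (auto simp: prod_zero_iff)
  also have "\<dots> = d l0 * (\<Prod>k\<in>L - {l0}. l0 - k)" using L by simp
  finally have "poly q l0 \<noteq> 0" using L by (auto simp: prod_zero_iff)
  then have "q \<noteq> 0" by auto
  moreover have "(\<lambda>x. poly q (g x)) \<in> I"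
  proof -
    \<comment> \<open>The multipliers are chosen so that each \<open>h l\<close> appears with the
      common factor \<open>\<Prod>k\<in>L. g x - k\<close>; the terms with \<open>h l\<close> then
      add up to a multiple of the vanishing relation and \<open>poly q (g x)\<close>
      remains.\<close>
    define p where "p l x = - d l * (\<Prod>k\<in>L - {l}. g x - k)" for l x
    have pA: "p l \<in> gen_alg G" for l
      unfolding p_def by (intro gen_alg.mult gen_alg_prod gen_alg_diff gen_alg.const assms(3))
    have "(\<lambda>x. \<Sum>l\<in>L. p l x * (h l x * (g x - l) - 1)) \<in> I"
      using L h(2) pA by (intro alg_ideal_sum[OF assms(2)] alg_idealD(4)[OF assms(2)]) auto
    moreover have "(\<Sum>l\<in>L. p l x * (h l x * (g x - l) - 1)) = poly q (g x)" for x
    proof -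
      have "p l x * (h l x * (g x - l) - 1) =
          d l * (\<Prod>k\<in>L - {l}. g x - k) - (\<Prod>k\<in>L. g x - k) * (d l * h l x)" if "l \<in> L" for l
        unfolding p_def prod.remove[OF L(1) that] by (simp add: algebra_simps)
      then have "(\<Sum>l\<in>L. p l x * (h l x * (g x - l) - 1)) =
          poly q (g x) - (\<Prod>k\<in>L. g x - k) * (\<Sum>l\<in>L. d l * h l x)"
        by (simp add: polyq sum_subtractf sum_distrib_left)
      then show ?thesis by (simp add: rel)
    qed
    ultimately show ?thesis by simp
  qed
  ultimately show thesis by (rule that)
qed

definition maximal_alg_ideal :: "('a \<Rightarrow> complex) set \<Rightarrow> ('a \<Rightarrow> complex) set \<Rightarrow> bool" where
  "maximal_alg_ideal A I \<longleftrightarrow> alg_ideal A I \<and> (\<lambda>x. 1) \<notin> I \<and>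
     (\<forall>J. alg_ideal A J \<longrightarrow> I \<subseteq> J \<longrightarrow> (\<lambda>x. 1) \<notin> J \<longrightarrow> J = I)"

lemma exists_maximal_alg_ideal:
  assumes "alg_ideal A I" "(\<lambda>x. 1) \<notin> I"
  obtains J where "maximal_alg_ideal A J" "I \<subseteq> J"
proof -
  define S where "S = {J. alg_ideal A J \<and> I \<subseteq> J \<and> (\<lambda>x. 1) \<notin> J}"
  have "S \<noteq> {}" using assms by (auto simp: S_def)
  moreover have "\<Union>C \<in> S" if C: "C \<noteq> {}" "subset.chain S C" for C
  proof -
    have CS: "C \<subseteq> S" using C by (auto simp: subset.chain_def)
    have "(\<lambda>x. f x + g x) \<in> \<Union>C" if fg: "f \<in> \<Union>C" "g \<in> \<Union>C" for f g
    proof -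
      obtain X Y where "X \<in> C" "Y \<in> C" "f \<in> X" "g \<in> Y" using fg by blast
      then obtain Z where "Z \<in> C" "f \<in> Z" "g \<in> Z"
        using C(2) unfolding subset_chain_def by (metis subsetD)
      then show ?thesis using CS unfolding S_def alg_ideal_def by blast
    qed
    moreover have "\<Union>C \<subseteq> A" "(\<lambda>x. 0) \<in> \<Union>C"
      using C(1) CS unfolding alg_ideal_def S_def by blast+
    moreover have "(\<lambda>x. f x * g x) \<in> \<Union>C" if "f \<in> A" "g \<in> \<Union>C" for f g
    proof -
      obtain X where "X \<in> C" "g \<in> X" using \<open>g \<in> \<Union>C\<close> by blast
      then show ?thesis using CS \<open>f \<in> A\<close> unfolding S_def alg_ideal_def by blast
    qed
    ultimately have "alg_ideal A (\<Union>C)" unfolding alg_ideal_def by blast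
    then show ?thesis using C(1) CS unfolding S_def by blast
  qed
  ultimately obtain M where "M \<in> S" "\<forall>X\<in>S. M \<subseteq> X \<longrightarrow> X = M"
    using subset_Zorn_nonempty[of S] by blast
  then show thesis using that[of M] unfolding maximal_alg_ideal_def S_def by blast
qed

text \<open>The ideal generated by \<open>M\<close> and \<open>t\<close> is strictly larger than
  \<open>M\<close>, so by maximality it contains \<open>1\<close>; writing \<open>1\<close> as an
  element of it exhibits the inverse.\<close>

lemma maximal_alg_ideal_inverse:
  assumes "maximal_alg_ideal (gen_alg G) M" "t \<in> gen_alg G" "t \<notin> M"
  shows "\<exists>h\<in>gen_alg G. (\<lambda>x. h x * t x - 1) \<in> M"
proof -
  have M: "alg_ideal (gen_alg G) M" using assms(1) by (simp add: maximal_alg_ideal_def)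
  define J where "J = {(\<lambda>x. h x * t x + m x) | h m. h \<in> gen_alg G \<and> m \<in> M}"
  have JI: "(\<lambda>x. h x * t x + m x) \<in> J" if "h \<in> gen_alg G" "m \<in> M" for h m
    using that unfolding J_def by blast
  have Jid: "alg_ideal (gen_alg G) J"
    unfolding alg_ideal_def
  proof (intro conjI ballI)
    show "J \<subseteq> gen_alg G"
      unfolding J_def using assms(2) alg_idealD(1)[OF M] by (auto intro: gen_alg.intros)
    show "(\<lambda>x. 0) \<in> J" using JI[OF gen_alg.const[of 0] alg_idealD(2)[OF M]] by simp
  next
    fix f g assume "f \<in> J" "g \<in> J"
    then obtain h m h' m' where *: "h \<in> gen_alg G" "m \<in> M" "f = (\<lambda>x. h x * t x + m x)"
      "h' \<in> gen_alg G" "m' \<in> M" "g = (\<lambda>x. h' x * t x + m' x)" unfolding J_def by blast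
    from JI[OF gen_alg.add[OF *(1,4)] alg_idealD(3)[OF M *(2,5)]]
    show "(\<lambda>x. f x + g x) \<in> J" unfolding * by (simp add: algebra_simps)
  next
    fix f g assume f: "f \<in> gen_alg G" and "g \<in> J"
    then obtain h m where *: "h \<in> gen_alg G" "m \<in> M" "g = (\<lambda>x. h x * t x + m x)"
      unfolding J_def by blast
    from JI[OF gen_alg.mult[OF f *(1)] alg_idealD(4)[OF M f *(2)]]
    show "(\<lambda>x. f x * g x) \<in> J" unfolding * by (simp add: algebra_simps)
  qed
  have "M \<subseteq> J"
  proof
    fix m assume "m \<in> M"
    from JI[OF gen_alg.const[of 0] this] show "m \<in> J" by simp
  qed
  have "t \<in> J" using JI[OF gen_alg.const[of 1] alg_idealD(2)[OF M]] by simp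
  then have "J \<noteq> M" using assms(3) by blast
  then have "(\<lambda>x. 1) \<in> J"
    using assms(1) Jid \<open>M \<subseteq> J\<close> unfolding maximal_alg_ideal_def by blast
  then obtain h m where hm: "h \<in> gen_alg G" "m \<in> M" "(\<lambda>x. 1) = (\<lambda>x. h x * t x + m x)"
    unfolding J_def by blast
  have "(\<lambda>x. (\<lambda>x. - 1) x * m x) \<in> M"
    by (rule alg_idealD(4)[OF M gen_alg.const hm(2)])
  moreover have "h x * t x - 1 = - 1 * m x" for x using fun_cong[OF hm(3), of x] by (simp add: algebra_simps)
  ultimately show ?thesis using hm(1) by (intro bexI[of _ h]) simp_all
qed

text \<open>The residue field is the field of complex numbers. If no \<open>t - l\<close> lay in
  \<open>M\<close>, all of them would be invertible modulo \<open>M\<close>, which makes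
  \<open>t\<close> algebraic modulo \<open>M\<close>; over an algebraically closed field this is
  absurd. Uniqueness holds because \<open>M\<close> contains no constant other than
  \<open>0\<close>.\<close>

lemma maximal_alg_ideal_residue:
  assumes G: "countable G" and max: "maximal_alg_ideal (gen_alg G) M" and t: "t \<in> gen_alg G"
  shows "\<exists>!l. (\<lambda>x. t x - l) \<in> M"
proof (rule ex_ex1I)
  have M: "alg_ideal (gen_alg G) M" and one: "(\<lambda>x. 1) \<notin> M"
    using max by (simp_all add: maximal_alg_ideal_def)
  have const_notin: "c = 0" if "(\<lambda>x. c) \<in> M" for c
  proof (rule ccontr)
    assume "c \<noteq> 0"
    with alg_idealD(4)[OF M gen_alg.const[of "1 / c"] that] one show False by simp
  qed
  show "\<exists>l. (\<lambda>x. t x - l) \<in> M"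
  proof (rule ccontr)
    assume neg: "\<not> ?thesis"
    have inv: "\<exists>h\<in>gen_alg G. (\<lambda>x. h x * (t x - l) - 1) \<in> M" for l
      by (rule maximal_alg_ideal_inverse[OF max gen_alg_diff[OF t gen_alg.const]]) (use neg in blast)
    have "uncountable (UNIV :: complex set)" by (rule uncountable_UNIV_complex)
    then obtain q where q: "q \<noteq> 0" "(\<lambda>x. poly q (t x)) \<in> M"
      using uncountably_many_inverses_imp_algebraic[OF G M t] inv by metis
    \<comment> \<open>Descent on the degree: \<open>q\<close> has a root \<open>l\<close>, and since
      \<open>t - l\<close> is invertible modulo \<open>M\<close>, the corresponding linear factor
      can be cancelled, down to a non-zero constant in \<open>M\<close>.\<close>
    have "\<not> (q \<noteq> 0 \<and> (\<lambda>x. poly q (t x)) \<in> M)" for q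
    proof (induction "degree q" arbitrary: q)
      case 0
      then obtain c where "q = [:c:]" by (metis degree_eq_zeroE)
      then show ?case using const_notin[of c] by auto
    next
      case (Suc n)
      show ?case
      proof safe
        assume q: "q \<noteq> 0" "(\<lambda>x. poly q (t x)) \<in> M"
        have "\<not> constant (poly q)" using Suc(2) constant_degree[of q] by simp
        then obtain l where "poly q l = 0" using fundamental_theorem_of_algebra by blast
        then obtain p where p: "q = [:-l, 1:] * p" using poly_eq_0_iff_dvd by (metis dvdE)
        have p0: "p \<noteq> 0" using q p by auto
        have "degree q = Suc (degree p)" unfolding p using p0 by (subst degree_mult_eq) auto
        then have "\<not> (\<lambda>x. poly p (t x)) \<in> M" using Suc p0 by auto
        moreover have "(\<lambda>x. poly p (t x)) \<in> M"
        proof -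
          obtain h where h: "h \<in> gen_alg G" "(\<lambda>x. h x * (t x - l) - 1) \<in> M" using inv by blast
          have 1: "(\<lambda>x. h x * poly q (t x)) \<in> M" by (rule alg_idealD(4)[OF M h(1) q(2)])
          \<comment> \<open>The cancellation reads
            \<open>p(t) = h q(t) - p(t) (h (t - l) - 1)\<close>, with both terms on the right in
            \<open>M\<close>.\<close>
          have "(\<lambda>x. (- 1) * poly p (t x)) \<in> gen_alg G"
            by (intro gen_alg.mult gen_alg.const gen_alg_poly t)
          from alg_idealD(3)[OF M 1 alg_idealD(4)[OF M this h(2)]]
          show ?thesis by (simp add: p algebra_simps)
        qed
        ultimately show False by blast
      qed
    qed
    with q show False by blast
  qed
  fix l k assume lk: "(\<lambda>x. t x - l) \<in> M" "(\<lambda>x. t x - k) \<in> M"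
  have "(\<lambda>x. t x - l + (- 1) * (t x - k)) \<in> M"
    by (rule alg_idealD(3)[OF M lk(1) alg_idealD(4)[OF M gen_alg.const lk(2)]])
  then have "(\<lambda>x. k - l) \<in> M" by simp
  from const_notin[OF this] show "l = k" by simp
qed

section \<open>Characters with prescribed large values\<close>

definition alg_character :: "('a \<Rightarrow> complex) set \<Rightarrow> (('a \<Rightarrow> complex) \<Rightarrow> complex) \<Rightarrow> bool" where
  "alg_character A \<phi> \<longleftrightarrow> (\<forall>c. \<phi> (\<lambda>x. c) = c) \<and>
     (\<forall>s\<in>A. \<forall>t\<in>A. \<phi> (\<lambda>x. s x + t x) = \<phi> s + \<phi> t \<and> \<phi> (\<lambda>x. s x * t x) = \<phi> s * \<phi> t)"

text \<open>The value \<open>l\<close> is taken by a character as soon as \<open>g - l\<close> is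
  not a unit: a maximal ideal containing it yields the character as residue map. If all
  \<open>l\<close> of norm above \<open>N\<close> gave units, \<open>g\<close> would satisfy a
  polynomial equation and have finite range. The function \<open>g\<close> itself may well be
  bounded.\<close>

lemma exists_character_with_large_value:
  assumes "countable G" "g \<in> gen_alg G" "infinite (range g)"
  shows "\<exists>\<phi>. alg_character (gen_alg G) \<phi> \<and> norm (\<phi> g) > N"
proof -
  let ?A = "gen_alg G"
  have zero: "alg_ideal ?A {\<lambda>x. 0}"
    unfolding alg_ideal_def by (auto intro: gen_alg.const)
  have "uncountable {l :: complex. norm l > N}"
  proof -
    \<comment> \<open>The absolute value allows for negative \<open>N\<close>; all points of this
      disc have norm greater than \<open>\<bar>N\<bar>\<close>.\<close>
    have "uncountable (ball (of_real (\<bar>N\<bar> + 1)) 1 :: complex set)" by (rule uncountable_ball) simp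
    moreover have "(ball (of_real (\<bar>N\<bar> + 1)) 1 :: complex set) \<subseteq> {l. norm l > N}"
    proof
      fix l :: complex assume "l \<in> ball (of_real (\<bar>N\<bar> + 1)) 1"
      then have "norm (complex_of_real (\<bar>N\<bar> + 1) - l) < 1" by (simp add: dist_norm)
      moreover have "norm (complex_of_real (\<bar>N\<bar> + 1)) \<le> norm (complex_of_real (\<bar>N\<bar> + 1) - l) + norm l"
        using norm_triangle_ineq[of "complex_of_real (\<bar>N\<bar> + 1) - l" l] by simp
      moreover have "norm (complex_of_real (\<bar>N\<bar> + 1)) = \<bar>N\<bar> + 1" by (simp only: norm_of_real)
      ultimately show "l \<in> {l. norm l > N}" by auto
    qed
    ultimately show ?thesis using countable_subset by blast
  qed
  then have "\<exists>l. norm l > N \<and> \<not> (\<exists>h\<in>?A. (\<lambda>x. h x * (g x - l) - 1) \<in> {\<lambda>x. 0})"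
  proof (rule contrapos_pp)
    assume "\<not> ?thesis"
    then have inv: "\<And>l. l \<in> {l. norm l > N} \<Longrightarrow> \<exists>h\<in>?A. (\<lambda>x. h x * (g x - l) - 1) \<in> {\<lambda>x. 0}" by blast
    show "\<not> uncountable {l :: complex. norm l > N}"
    proof
      assume unc: "uncountable {l :: complex. norm l > N}"
      from uncountably_many_inverses_imp_algebraic[OF assms(1) zero assms(2) unc inv]
      obtain q where q: "q \<noteq> 0" "(\<lambda>x. poly q (g x)) = (\<lambda>x. 0)" by (metis singletonD)
      have "range g \<subseteq> {y. poly q y = 0}" using fun_cong[OF q(2)] by auto
      then show False using assms(3) poly_roots_finite[OF q(1)] finite_subset by blast
    qed
  qed
  then obtain l where l: "norm l > N" "\<And>h. h \<in> ?A \<Longrightarrow> (\<lambda>x. h x * (g x - l)) \<noteq> (\<lambda>x. 1)"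
    by (auto simp: fun_eq_iff)
  define I where "I = {(\<lambda>x. h x * (g x - l)) | h. h \<in> ?A}"
  have II: "(\<lambda>x. h x * (g x - l)) \<in> I" if "h \<in> ?A" for h
    using that unfolding I_def by blast
  have gl: "(\<lambda>x. g x - l) \<in> ?A" by (intro gen_alg_diff assms(2) gen_alg.const)
  have "alg_ideal ?A I" unfolding alg_ideal_def
  proof (intro conjI ballI)
    show "I \<subseteq> ?A" unfolding I_def using gl by (auto intro: gen_alg.mult)
    show "(\<lambda>x. 0) \<in> I" using II[OF gen_alg.const[of 0]] by simp
  next
    fix s t assume "s \<in> I" "t \<in> I"
    then obtain h k where *: "h \<in> ?A" "k \<in> ?A" "s = (\<lambda>x. h x * (g x - l))" "t = (\<lambda>x. k x * (g x - l))"
      unfolding I_def by blast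
    from II[OF gen_alg.add[OF *(1,2)]] show "(\<lambda>x. s x + t x) \<in> I" by (simp add: * algebra_simps)
  next
    fix s t assume s: "s \<in> ?A" and "t \<in> I"
    then obtain k where *: "k \<in> ?A" "t = (\<lambda>x. k x * (g x - l))"
      unfolding I_def by blast
    from II[OF gen_alg.mult[OF s *(1)]] show "(\<lambda>x. s x * t x) \<in> I" by (simp add: * algebra_simps)
  qed
  moreover have "(\<lambda>x. 1) \<notin> I"
    unfolding I_def
  proof
    assume "(\<lambda>x. 1) \<in> {(\<lambda>x. h x * (g x - l)) | h. h \<in> ?A}"
    then show False using l(2) by force
  qed
  ultimately obtain M where M: "maximal_alg_ideal ?A M" "I \<subseteq> M" by (rule exists_maximal_alg_ideal)
  have Mid: "alg_ideal ?A M" using M by (simp add: maximal_alg_ideal_def)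
  define \<phi> where "\<phi> t = (THE l. (\<lambda>x. t x - l) \<in> M)" for t
  have \<phi>: "(\<lambda>x. t x - \<phi> t) \<in> M" if "t \<in> ?A" for t
    unfolding \<phi>_def by (rule theI'[OF maximal_alg_ideal_residue[OF assms(1) M(1) that]])
  have \<phi>_eq: "\<phi> t = c" if "t \<in> ?A" "(\<lambda>x. t x - c) \<in> M" for t c
    using \<phi>[OF that(1)] that(2) maximal_alg_ideal_residue[OF assms(1) M(1) that(1)] by blast
  have "alg_character ?A \<phi>"
    unfolding alg_character_def
  proof (intro conjI allI ballI)
    show "\<phi> (\<lambda>x. c) = c" for c
      by (rule \<phi>_eq) (use alg_idealD(2)[OF Mid] in \<open>simp_all add: gen_alg.const\<close>)
    fix s t assume st: "s \<in> ?A" "t \<in> ?A"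
    show "\<phi> (\<lambda>x. s x + t x) = \<phi> s + \<phi> t"
      by (rule \<phi>_eq[OF gen_alg.add[OF st]])
        (use alg_idealD(3)[OF Mid \<phi>[OF st(1)] \<phi>[OF st(2)]] in \<open>simp add: algebra_simps\<close>)
    \<comment> \<open>This sum equals \<open>s t - \<phi>(s) \<phi>(t)\<close>.\<close>
    have "(\<lambda>x. s x * (t x - \<phi> t) + \<phi> t * (s x - \<phi> s)) \<in> M"
      by (rule alg_idealD(3)[OF Mid alg_idealD(4)[OF Mid st(1) \<phi>[OF st(2)]]
            alg_idealD(4)[OF Mid gen_alg.const \<phi>[OF st(1)]]])
    then show "\<phi> (\<lambda>x. s x * t x) = \<phi> s * \<phi> t"
      by (intro \<phi>_eq[OF gen_alg.mult[OF st]]) (simp add: algebra_simps)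
  qed
  moreover have "\<phi> g = l"
    using II[OF gen_alg.const[of 1]] M(2) by (intro \<phi>_eq[OF assms(2)]) auto
  ultimately show ?thesis using l by blast
qed

section \<open>Zeros of functions of finite rank\<close>

lemma uniform_limit_sum:
  fixes f :: "'i \<Rightarrow> 'n \<Rightarrow> 'x \<Rightarrow> 'a::real_normed_vector"
  assumes "\<And>i. i \<in> I \<Longrightarrow> uniform_limit X (f i) (l i) F"
  shows "uniform_limit X (\<lambda>n w. \<Sum>i\<in>I. f i n w) (\<lambda>w. \<Sum>i\<in>I. l i w) F"
  using assms
  by (induction I rule: infinite_finite_induct) (auto intro: uniform_limit_const uniform_limit_add)

text \<open>Without loss of generality the \<open>K\<^sub>i\<close> are linearly independent. Then the functions divided by the
  norms of their coefficient vectors subconverge to a limit that is not identically zero but vanishes at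
  \<open>0\<close>, so by Hurwitz's theorem they cannot all be free of zeros.\<close>

lemma normalized_unbounded_family_has_zero:
  fixes K :: "'i::finite \<Rightarrow> complex \<Rightarrow> complex" and a :: "nat \<Rightarrow> 'i \<Rightarrow> complex"
  assumes r: "r > 0" and hol: "\<And>i. K i holomorphic_on ball 0 r" and w1: "w1 \<in> ball 0 r"
    and norm1: "\<And>n. (\<Sum>i\<in>I. a n i * K i 0) = 1"
    and large: "\<And>n. norm (\<Sum>i\<in>I. a n i * K i w1) > real n"
  shows "\<exists>n. \<exists>w\<in>ball 0 r. (\<Sum>i\<in>I. a n i * K i w) = 0"
  using norm1 large
proof (induction "card I" arbitrary: I a rule: less_induct)
  case (less I a)
  show ?case
  proof (cases "\<exists>d. (\<exists>i\<in>I. d i \<noteq> 0) \<and> (\<forall>w\<in>ball 0 r. (\<Sum>i\<in>I. d i * K i w) = 0)")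
    case True
    then obtain d i0 where d: "i0 \<in> I" "d i0 \<noteq> 0" "\<And>w. w \<in> ball 0 r \<Longrightarrow> (\<Sum>i\<in>I. d i * K i w) = 0"
      by blast
    \<comment> \<open>A multiple of the relation \<open>d\<close> is subtracted to make the
      coefficient at \<open>i0\<close> vanish. The functions on the disc are unchanged, so the
      induction hypothesis applies to \<open>I - {i0}\<close>.\<close>
    define b where "b n i = a n i - a n i0 / d i0 * d i" for n i
    have b: "(\<Sum>i\<in>I - {i0}. b n i * K i w) = (\<Sum>i\<in>I. a n i * K i w)" if "w \<in> ball 0 r" for n w
    proof -
      have "(\<Sum>i\<in>I. b n i * K i w) = b n i0 * K i0 w + (\<Sum>i\<in>I - {i0}. b n i * K i w)"
        by (rule sum.remove) (use d in auto)
      moreover have "b n i0 = 0" using d by (simp add: b_def)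
      moreover have "(\<Sum>i\<in>I. b n i * K i w) =
          (\<Sum>i\<in>I. a n i * K i w) - a n i0 / d i0 * (\<Sum>i\<in>I. d i * K i w)"
        by (simp add: b_def algebra_simps sum_subtractf sum_distrib_left)
      ultimately show ?thesis using d(3)[OF that] by simp
    qed
    have "card (I - {i0}) < card I" using d(1) by (intro psubset_card_mono) auto
    from less.hyps[OF this, of b] show ?thesis
      using less.prems b r w1 by simp
  next
    case False
    define v where "v n = (\<chi> i. if i \<in> I then a n i else 0)" for n
    define C where "C = (\<Sum>i\<in>I. norm (K i w1))"
    have vK: "(\<Sum>i\<in>I. v n $ i * K i w) = (\<Sum>i\<in>I. a n i * K i w)" for n w
      by (intro sum.cong) (auto simp: v_def)
    \<comment> \<open>Large values at the fixed point \<open>w1\<close> force the coefficient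
      vectors to tend to infinity in norm. Dividing by these norms sends the value \<open>1\<close>
      at \<open>0\<close> to \<open>0\<close>.\<close>
    have bound: "real n < norm (v n) * C" for n
    proof -
      have "norm (\<Sum>i\<in>I. v n $ i * K i w1) \<le> (\<Sum>i\<in>I. norm (v n) * norm (K i w1))"
        by (intro order_trans[OF norm_sum] sum_mono)
          (auto simp: norm_mult intro!: mult_right_mono Finite_Cartesian_Product.norm_nth_le)
      with less.prems(2)[of n] show ?thesis by (simp add: vK C_def sum_distrib_left)
    qed
    have C0: "C \<ge> 0" unfolding C_def by (intro sum_nonneg) auto
    have Cpos: "C > 0" using bound[of 0] C0 by (cases "C = 0") auto
    have vpos: "norm (v n) > 0" for n
      using bound[of n] by (cases "v n = 0") auto
    have vinf: "filterlim (\<lambda>n. norm (v n)) at_top sequentially"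
    proof (rule filterlim_at_top_mono)
      show "filterlim (\<lambda>n. (1 / C) * real n) at_top sequentially"
        using Cpos by (intro filterlim_tendsto_pos_mult_at_top[OF tendsto_const] filterlim_real_sequentially) simp
      show "\<forall>\<^sub>F n in sequentially. 1 / C * real n \<le> norm (v n)"
        using bound Cpos by (intro always_eventually) (auto simp: field_simps intro: less_imp_le)
    qed
    define u where "u n = (1 / norm (v n)) *\<^sub>R v n" for n
    have uc: "u n $ i = v n $ i / norm (v n)" for n i 
      by (simp add: u_def, simp add: scaleR_conv_of_real divide_simps)
    have "u n \<in> sphere 0 1" for n using vpos[of n] by (simp add: u_def)
    then obtain l \<rho> where l: "l \<in> sphere 0 1" and \<rho>: "strict_mono (\<rho> :: nat \<Rightarrow> nat)"
      and lim: "(u \<circ> \<rho>) \<longlonglongrightarrow> l"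
      using compact_imp_seq_compact[OF compact_sphere, of "0 :: complex^'i" 1] unfolding seq_compact_def by metis
    have limc: "(\<lambda>n. u (\<rho> n) $ i) \<longlonglongrightarrow> l $ i" for i
      using tendsto_vec_nth[OF lim, of i] by (simp add: o_def)
    \<comment> \<open>The limit is a unit vector supported in \<open>I\<close>, so independence of
      the \<open>K i\<close> with \<open>i\<close> in \<open>I\<close> makes \<open>g\<close>
      non-zero somewhere.\<close>
    have l0: "l $ i = 0" if "i \<notin> I" for i
      using limc[of i] that by (simp add: uc v_def LIMSEQ_const_iff)
    define g where "g w = (\<Sum>i\<in>I. l $ i * K i w)" for w
    have "\<exists>i\<in>I. l $ i \<noteq> 0"
    proof (rule ccontr)
      assume "\<not> ?thesis"
      then have "l = 0" using l0 by (auto simp: vec_eq_iff)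
      with l show False by simp
    qed
    then obtain w2 where w2: "w2 \<in> ball 0 r" "g w2 \<noteq> 0"
      using False unfolding g_def by blast
    have g0: "g 0 = 0"
    proof -
      have "(\<lambda>n. \<Sum>i\<in>I. u (\<rho> n) $ i * K i 0) \<longlonglongrightarrow> g 0"
        unfolding g_def by (intro tendsto_intros limc)
      moreover have "(\<Sum>i\<in>I. u n $ i * K i 0) = of_real (1 / norm (v n))" for n
      proof -
        have "(\<Sum>i\<in>I. u n $ i * K i 0) = (\<Sum>i\<in>I. v n $ i * K i 0) / norm (v n)"
          by (simp add: uc sum_divide_distrib)
        then show ?thesis by (simp add: vK less.prems(1))
      qed
      moreover have "(\<lambda>n. complex_of_real (1 / norm (v (\<rho> n)))) \<longlonglongrightarrow> of_real 0"
        by (intro tendsto_of_real filterlim_compose[OF tendsto_divide_0[OF tendsto_const]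
              filterlim_at_top_imp_at_infinity] filterlim_compose[OF vinf] filterlim_subseq \<rho>)
          (rule filterlim_ident)
      ultimately show ?thesis using LIMSEQ_unique by fastforce
    qed
    show ?thesis
    proof (rule ccontr)
      assume neg: "\<not> ?thesis"
      have "g 0 \<noteq> 0"
      proof (rule Hurwitz_no_zeros[where S = "ball 0 r" and g = g and ?z0.0 = 0 and \<F> = "\<lambda>n w. \<Sum>i\<in>I. u (\<rho> n) $ i * K i w"])
        show "(\<lambda>w. \<Sum>i\<in>I. u (\<rho> n) $ i * K i w) holomorphic_on ball 0 r" for n
          by (intro holomorphic_intros hol)
        show "g holomorphic_on ball 0 r" unfolding g_def by (intro holomorphic_intros hol)
        show "\<not> g constant_on ball 0 r"
        proof
          assume "g constant_on ball 0 r"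
          then have "g w2 = g 0" using w2(1) r unfolding constant_on_def by force
          with g0 w2(2) show False by simp
        qed
        show "(\<Sum>i\<in>I. u (\<rho> n) $ i * K i w) \<noteq> 0" if "w \<in> ball 0 r" for n w
        proof -
          have "(\<Sum>i\<in>I. u (\<rho> n) $ i * K i w) = (\<Sum>i\<in>I. v (\<rho> n) $ i * K i w) / norm (v (\<rho> n))"
            by (simp add: uc sum_divide_distrib)
          with neg that vpos[of "\<rho> n"] show ?thesis by (simp add: vK)
        qed
        fix X :: "complex set" assume X: "compact X" "X \<subseteq> ball 0 r"
        show "uniform_limit X (\<lambda>n w. \<Sum>i\<in>I. u (\<rho> n) $ i * K i w) g sequentially"
          unfolding g_def
        proof (intro uniform_limit_sum)
          fix i assume "i \<in> I"
          have "bounded (K i ` X)"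
            by (intro compact_imp_bounded compact_continuous_image X holomorphic_on_imp_continuous_on
                holomorphic_on_subset[OF hol X(2)])
          moreover have "uniform_limit X (\<lambda>n w. u (\<rho> n) $ i) (\<lambda>w. l $ i) sequentially"
            unfolding uniform_limit_iff using limc[of i] by (auto simp: tendsto_iff)
          ultimately show "uniform_limit X (\<lambda>n w. u (\<rho> n) $ i * K i w) (\<lambda>w. l $ i * K i w) sequentially"
            by (intro uniform_lim_mult uniform_limit_const) (auto simp: image_constant_conv)
        qed
      qed (use r in auto)
      with g0 show False by simp
    qed
  qed
qed

section \<open>Orders of vanishing and the exponent\<close>

lemma holomorphic_factor_zero:
  assumes "f holomorphic_on ball 0 r" "f 0 \<noteq> 0" "w \<in> ball 0 r"
  obtains n s h where "s > 0" "ball w s \<subseteq> ball 0 r" "h holomorphic_on ball w s" "h w \<noteq> 0"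
    "\<And>z. z \<in> ball w s \<Longrightarrow> f z = (z - w) ^ n * h z" "f w = 0 \<Longrightarrow> n > 0"
proof (cases "f w = 0")
  case True
  have r: "r > 0" using assms(3) by (auto simp: dist_norm intro: le_less_trans[OF norm_ge_zero])
  have "\<not> f constant_on ball 0 r"
  proof
    assume "f constant_on ball 0 r"
    then have "f w = f 0" using assms(3) r unfolding constant_on_def by force
    with True assms(2) show False by simp
  qed
  from holomorphic_factor_zero_nonconstant[OF assms(1) open_ball connected_ball assms(3) True this]
  obtain g s n where "0 < n" "0 < s" "ball w s \<subseteq> ball 0 r" "g holomorphic_on ball w s"
    "\<And>z. z \<in> ball w s \<Longrightarrow> f z = (z - w) ^ n * g z" "\<And>z. z \<in> ball w s \<Longrightarrow> g z \<noteq> 0"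
    by metis
  then show thesis using that[of s g n] by simp
next
  case False
  obtain s where "s > 0" "ball w s \<subseteq> ball 0 r"
    using assms(3) open_ball open_contains_ball by metis
  then show thesis using that[of s f 0] False assms(1) holomorphic_on_subset by auto
qed

text \<open>The equation says \<open>c f'/f = g'/g\<close>, and the residues of the two sides at
  \<open>w\<close> are \<open>c\<close> times the order of \<open>f\<close> and the order of
  \<open>g\<close>. The order of \<open>f\<close> is positive, so it can serve as
  denominator.\<close>

lemma exponent_is_ratio_of_orders:
  assumes f: "f holomorphic_on ball 0 r" "f 0 \<noteq> 0" and g: "g holomorphic_on ball 0 r" "g 0 \<noteq> 0"
    and w: "w \<in> ball 0 r" "f w = 0"
    and eq: "\<And>z. z \<in> ball 0 r \<Longrightarrow> c * deriv f z * g z = f z * deriv g z"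
  shows "\<exists>p q :: nat. q > 0 \<and> c = of_nat p / of_nat q"
proof -
  obtain n s h where h: "s > 0" "ball w s \<subseteq> ball 0 r" "h holomorphic_on ball w s" "h w \<noteq> 0"
    "\<And>z. z \<in> ball w s \<Longrightarrow> f z = (z - w) ^ n * h z" "n > 0"
    using holomorphic_factor_zero[OF f w(1)] w(2) by metis
  obtain m t k where k: "t > 0" "ball w t \<subseteq> ball 0 r" "k holomorphic_on ball w t" "k w \<noteq> 0"
    "\<And>z. z \<in> ball w t \<Longrightarrow> g z = (z - w) ^ m * k z"
    using holomorphic_factor_zero[OF g w(1)] by metis
  define e where "e = min s t"
  have e: "e > 0" "ball w e \<subseteq> ball w s" "ball w e \<subseteq> ball w t" using h k by (auto simp: e_def)
  \<comment> \<open>Multiplication by \<open>z - w\<close> avoids the exponent \<open>N - 1\<close>,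
    which truncates for \<open>N = 0\<close>.\<close>
  have der: "(z - w) * deriv \<phi> z = (z - w) ^ N * (of_nat N * \<psi> z + (z - w) * deriv \<psi> z)"
    if "\<psi> holomorphic_on ball w e" "\<And>z. z \<in> ball w e \<Longrightarrow> \<phi> z = (z - w) ^ N * \<psi> z" "z \<in> ball w e"
    for \<phi> \<psi> N z
  proof -
    have "(\<psi> has_field_derivative deriv \<psi> z) (at z)"
      using that by (intro holomorphic_derivI[OF _ open_ball])
    then have "((\<lambda>z. (z - w) ^ N * \<psi> z) has_field_derivative
        (of_nat N * (z - w) ^ (N - 1) * \<psi> z + (z - w) ^ N * deriv \<psi> z)) (at z)"
      by (auto intro!: derivative_eq_intros)
    then have "deriv (\<lambda>z. (z - w) ^ N * \<psi> z) z =
        of_nat N * (z - w) ^ (N - 1) * \<psi> z + (z - w) ^ N * deriv \<psi> z" by (rule DERIV_imp_deriv)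
    moreover have "deriv \<phi> z = deriv (\<lambda>z. (z - w) ^ N * \<psi> z) z"
      using that(2,3) by (intro deriv_cong_ev eventually_nhds_in_open[THEN eventually_mono, of "ball w e"]) auto
    ultimately have "deriv \<phi> z = of_nat N * (z - w) ^ (N - 1) * \<psi> z + (z - w) ^ N * deriv \<psi> z"
      by simp
    then show ?thesis by (cases N) (simp_all add: distrib_left mult_ac del: of_nat_Suc)
  qed
  \<comment> \<open>\<open>B\<close> is what remains of the equation after cancelling all powers of
    \<open>z - w\<close>. It vanishes off \<open>w\<close>, hence by continuity at \<open>w\<close>,
    where it equals \<open>(c n - m) h(w) k(w)\<close>.\<close>
  define B where "B z = c * (of_nat n * h z + (z - w) * deriv h z) * k z
      - h z * (of_nat m * k z + (z - w) * deriv k z)" for z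
  have B0: "B z = 0" if z: "z \<in> ball w e - {w}" for z
  proof -
    have hz: "(z - w) * deriv f z = (z - w) ^ n * (of_nat n * h z + (z - w) * deriv h z)"
      using z e h by (intro der) (auto intro: holomorphic_on_subset)
    have kz: "(z - w) * deriv g z = (z - w) ^ m * (of_nat m * k z + (z - w) * deriv k z)"
      using z e k by (intro der) (auto intro: holomorphic_on_subset)
    have zs: "f z = (z - w) ^ n * h z" "g z = (z - w) ^ m * k z" "z \<in> ball 0 r"
    proof -
      have "z \<in> ball w s" "z \<in> ball w t" using z e by blast+
      then show "f z = (z - w) ^ n * h z" "g z = (z - w) ^ m * k z" "z \<in> ball 0 r"
        using h(2,5) k(5) by blast+
    qed
    have "c * ((z - w) * deriv f z) * g z = f z * ((z - w) * deriv g z)"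
      using arg_cong[OF eq[OF zs(3)], of "\<lambda>x. (z - w) * x"] by (simp add: mult_ac)
    then have "(z - w) ^ n * (z - w) ^ m * B z = 0"
      unfolding hz kz zs(1,2) B_def by (simp add: algebra_simps)
    then show ?thesis using z by auto
  qed
  have "B holomorphic_on ball w e" unfolding B_def
    using h(3) k(3) e by (intro holomorphic_intros) (auto intro: holomorphic_on_subset)
  then have "isCont B w"
    using e(1) continuous_on_eq_continuous_at[OF open_ball] holomorphic_on_imp_continuous_on
    by (metis centre_in_ball)
  then have "(B \<longlongrightarrow> B w) (at w)" by (simp add: isCont_def)
  moreover have "(B \<longlongrightarrow> 0) (at w)"
    using B0 e(1) by (intro tendsto_eventually) (auto simp: eventually_at dist_commute intro!: exI[of _ e])
  ultimately have "B w = 0" using LIM_unique by blast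
  then have "c * of_nat n = of_nat m" using h(4) k(4) by (simp add: B_def)
  then have "c = of_nat m / of_nat n" using h(6) by (simp add: field_simps)
  then show ?thesis using h(6) by blast
qed

text \<open>For fixed \<open>w\<close> the sums are elements of the algebra generated by the
  \<open>F i\<close> and \<open>G j\<close>, with constant coefficients \<open>K i w\<close> and so
  on. A character therefore just replaces each \<open>F i z\<close> and \<open>G j z\<close> by a
  number, and differentiation in \<open>w\<close>, which acts on the \<open>K i\<close> and
  \<open>M j\<close> alone, commutes with this.\<close>

lemma finite_rank_power_exponent:
  fixes F :: "'i::finite \<Rightarrow> 'a \<Rightarrow> complex" and G :: "'j::finite \<Rightarrow> 'a \<Rightarrow> complex"
  assumes r: "r > 0" and K: "\<And>i. K i holomorphic_on ball 0 r" and M: "\<And>j. M j holomorphic_on ball 0 r"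
    and F0: "\<And>z. (\<Sum>i\<in>UNIV. F i z * K i 0) = 1" and G0: "\<And>z. (\<Sum>j\<in>UNIV. G j z * M j 0) = 1"
    and eq: "\<And>z w. w \<in> ball 0 r \<Longrightarrow>
      c * (\<Sum>i\<in>UNIV. F i z * deriv (K i) w) * (\<Sum>j\<in>UNIV. G j z * M j w) =
      (\<Sum>i\<in>UNIV. F i z * K i w) * (\<Sum>j\<in>UNIV. G j z * deriv (M j) w)"
    and w1: "w1 \<in> ball 0 r" and inf: "infinite (range (\<lambda>z. \<Sum>i\<in>UNIV. F i z * K i w1))"
  shows "\<exists>p q :: nat. q > 0 \<and> c = of_nat p / of_nat q"
proof -
  define S where "S = range F \<union> range G"
  let ?A = "gen_alg S"
  have S: "countable S" by (simp add: S_def countable_finite)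
  have FA: "F i \<in> ?A" and GA: "G j \<in> ?A" for i j by (auto simp: S_def intro: gen_alg.gen)
  have FsA: "(\<lambda>z. \<Sum>i\<in>UNIV. F i z * x i) \<in> ?A" and GsA: "(\<lambda>z. \<Sum>j\<in>UNIV. G j z * y j) \<in> ?A" for x y
    by (intro gen_alg_sum gen_alg.mult gen_alg.const FA GA)+
  have "\<exists>\<phi>. alg_character ?A \<phi> \<and> norm (\<phi> (\<lambda>z. \<Sum>i\<in>UNIV. F i z * K i w1)) > real n" for n
    by (rule exists_character_with_large_value[OF S FsA inf])
  then obtain \<phi> where char: "\<And>n. alg_character ?A (\<phi> n)"
    and large: "\<And>n. norm (\<phi> n (\<lambda>z. \<Sum>i\<in>UNIV. F i z * K i w1)) > real n" by metis
  have \<phi>_const: "\<phi> n (\<lambda>x. c) = c" for n c using char[of n] by (simp add: alg_character_def)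
  have \<phi>_mult: "\<phi> n (\<lambda>x. s x * t x) = \<phi> n s * \<phi> n t" if "s \<in> ?A" "t \<in> ?A" for n s t
    using char[of n] that by (simp add: alg_character_def)
  have \<phi>_sum: "\<phi> n (\<lambda>z. \<Sum>i\<in>I. f i z * x i) = (\<Sum>i\<in>I. \<phi> n (f i) * x i)"
    if "finite I" "\<And>i. f i \<in> ?A" for n I f x
    using that(1)
  proof induction
    case (insert i I)
    have "\<phi> n (\<lambda>z. f i z * x i + (\<Sum>i\<in>I. f i z * x i)) = \<phi> n (\<lambda>z. f i z * x i) + \<phi> n (\<lambda>z. \<Sum>i\<in>I. f i z * x i)"
      using char[of n] by (simp add: alg_character_def gen_alg_sum gen_alg.mult gen_alg.const that(2))
    also have "\<phi> n (\<lambda>z. f i z * x i) = \<phi> n (f i) * x i"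
      using \<phi>_mult[OF that(2) gen_alg.const] by (simp add: \<phi>_const)
    finally show ?case using insert by simp
  qed (simp add: \<phi>_const)
  have "\<exists>n. \<exists>w\<in>ball 0 r. (\<Sum>i\<in>UNIV. \<phi> n (F i) * K i w) = 0"
  proof (rule normalized_unbounded_family_has_zero[OF r K w1])
    show "(\<Sum>i\<in>UNIV. \<phi> n (F i) * K i 0) = 1" for n
      using \<phi>_sum[of UNIV F n "\<lambda>i. K i 0"] by (simp add: FA F0 \<phi>_const)
    show "norm (\<Sum>i\<in>UNIV. \<phi> n (F i) * K i w1) > real n" for n
      using large[of n] by (simp add: \<phi>_sum FA)
  qed
  then obtain n w0 where w0: "w0 \<in> ball 0 r" "(\<Sum>i\<in>UNIV. \<phi> n (F i) * K i w0) = 0" by blast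
  define f where "f w = (\<Sum>i\<in>UNIV. \<phi> n (F i) * K i w)" for w
  define g where "g w = (\<Sum>j\<in>UNIV. \<phi> n (G j) * M j w)" for w
  show ?thesis
  proof (rule exponent_is_ratio_of_orders)
    show "f holomorphic_on ball 0 r" "g holomorphic_on ball 0 r"
      unfolding f_def g_def by (intro holomorphic_intros K M)+
    show "f 0 \<noteq> 0" using \<phi>_sum[of UNIV F n "\<lambda>i. K i 0"] by (simp add: FA F0 \<phi>_const f_def)
    show "g 0 \<noteq> 0" using \<phi>_sum[of UNIV G n "\<lambda>i. M i 0"] by (simp add: GA G0 \<phi>_const g_def)
    show "f w0 = 0" using w0 by (simp add: f_def)
    fix w :: complex assume w: "w \<in> ball 0 r"
    have "deriv f w = (\<Sum>i\<in>UNIV. \<phi> n (F i) * deriv (K i) w)"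
      unfolding f_def by (intro DERIV_imp_deriv DERIV_sum DERIV_cmult holomorphic_derivI[OF K open_ball w])
    also have "\<dots> = \<phi> n (\<lambda>z. \<Sum>i\<in>UNIV. F i z * deriv (K i) w)" by (simp add: \<phi>_sum FA)
    finally have f': "deriv f w = \<dots>" .
    have "deriv g w = (\<Sum>i\<in>UNIV. \<phi> n (G i) * deriv (M i) w)"
      unfolding g_def by (intro DERIV_imp_deriv DERIV_sum DERIV_cmult holomorphic_derivI[OF M open_ball w])
    also have "\<dots> = \<phi> n (\<lambda>z. \<Sum>i\<in>UNIV. G i z * deriv (M i) w)" by (simp add: \<phi>_sum GA)
    finally have g': "deriv g w = \<dots>" .
    have fw: "f w = \<phi> n (\<lambda>z. \<Sum>i\<in>UNIV. F i z * K i w)" by (simp add: \<phi>_sum FA f_def)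
    have gw: "g w = \<phi> n (\<lambda>z. \<Sum>i\<in>UNIV. G i z * M i w)" by (simp add: \<phi>_sum GA g_def)
    have "c * \<phi> n (\<lambda>z. \<Sum>i\<in>UNIV. F i z * deriv (K i) w) * \<phi> n (\<lambda>z. \<Sum>j\<in>UNIV. G j z * M j w) =
        \<phi> n (\<lambda>z. c * (\<Sum>i\<in>UNIV. F i z * deriv (K i) w) * (\<Sum>j\<in>UNIV. G j z * M j w))"
      using \<phi>_mult[OF gen_alg.mult[OF gen_alg.const FsA] GsA] \<phi>_mult[OF gen_alg.const FsA] \<phi>_const by simp
    also have "\<dots> = \<phi> n (\<lambda>z. (\<Sum>i\<in>UNIV. F i z * K i w) * (\<Sum>j\<in>UNIV. G j z * deriv (M j) w))"
      by (simp only: eq[OF w])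
    also have "\<dots> = \<phi> n (\<lambda>z. \<Sum>i\<in>UNIV. F i z * K i w) * \<phi> n (\<lambda>z. \<Sum>j\<in>UNIV. G j z * deriv (M j) w)"
      by (rule \<phi>_mult[OF FsA GsA])
    finally show "c * deriv f w * g w = f w * deriv g w" unfolding f' g' fw gw .
  qed (use w0 in auto)
qed

section \<open>Polarization\<close>

text \<open>Functions holomorphic in \<open>z\<close> and antiholomorphic in \<open>w\<close>,
  restricted to those built algebraically from functions of one variable: derivatives in
  \<open>z\<close> stay in the class by structural induction, without any theory of two complex
  variables.\<close>

inductive sesqui :: "complex set \<Rightarrow> (complex \<Rightarrow> complex \<Rightarrow> complex) \<Rightarrow> bool" for D where
  hol: "A holomorphic_on D \<Longrightarrow> sesqui D (\<lambda>z w. A z)"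
| antihol: "B holomorphic_on D \<Longrightarrow> sesqui D (\<lambda>z w. cnj (B w))"
| add: "sesqui D f \<Longrightarrow> sesqui D g \<Longrightarrow> sesqui D (\<lambda>z w. f z w + g z w)"
| mult: "sesqui D f \<Longrightarrow> sesqui D g \<Longrightarrow> sesqui D (\<lambda>z w. f z w * g z w)"

lemma sesqui_const: "sesqui D (\<lambda>z w. c)"
  by (rule sesqui.hol[of "\<lambda>z. c"]) simp

lemma sesqui_diff: "sesqui D f \<Longrightarrow> sesqui D g \<Longrightarrow> sesqui D (\<lambda>z w. f z w - g z w)"
  using sesqui.add[OF _ sesqui.mult[OF sesqui_const[of D "-1"]], of f g] by simp

lemma sesqui_sum: "(\<And>i. i \<in> I \<Longrightarrow> sesqui D (f i)) \<Longrightarrow> sesqui D (\<lambda>z w. \<Sum>i\<in>I. f i z w)"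
  by (induction I rule: infinite_finite_induct) (auto intro: sesqui_const sesqui.add)

text \<open>\<open>g1\<close> lies in the class again, so the statement can be iterated;
  \<open>g2\<close> only serves to describe the real derivative along the diagonal.\<close>

lemma sesqui_derivative:
  assumes "open D" "sesqui D g"
  shows "\<exists>g1 g2. sesqui D g1 \<and> (\<forall>z\<in>D. \<forall>w\<in>D. ((\<lambda>z. g z w) has_field_derivative g1 z w) (at z)) \<and>
    (\<forall>z\<in>D. ((\<lambda>z. g z z) has_derivative (\<lambda>h. h * g1 z z + cnj h * g2 z z)) (at z))"
  using assms(2)
proof induction
  case (hol A)
  have A: "(A has_field_derivative deriv A z) (at z)" if "z \<in> D" for z
    using holomorphic_derivI[OF hol assms(1) that] .
  have "sesqui D (\<lambda>z w. deriv A z)"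
    by (intro sesqui.hol holomorphic_deriv hol assms(1))
  moreover have "(A has_derivative (\<lambda>h. h * deriv A z + cnj h * 0)) (at z)" if "z \<in> D" for z
    using A[OF that] by (simp add: has_field_derivative_def mult_commute_abs)
  ultimately show ?case using A
    by (intro exI[of _ "\<lambda>z w. deriv A z"] exI[of _ "\<lambda>z w. 0"]) simp
next
  case (antihol B)
  have "((\<lambda>z. cnj (B z)) has_derivative (\<lambda>h. h * 0 + cnj h * cnj (deriv B z))) (at z)" if "z \<in> D" for z
  proof -
    have "(B has_derivative (\<lambda>h. deriv B z * h)) (at z)"
      using holomorphic_derivI[OF antihol assms(1) that] by (simp add: has_field_derivative_def)
    from has_derivative_cnj[OF this] show ?thesis by (simp add: mult.commute)
  qed
  then show ?case using sesqui_const
    by (intro exI[of _ "\<lambda>z w. 0"] exI[of _ "\<lambda>z w. cnj (deriv B z)"]) simp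
next
  case (add f g)
  then obtain f1 f2 g1 g2 where
    "sesqui D f1" "\<And>z w. z \<in> D \<Longrightarrow> w \<in> D \<Longrightarrow> ((\<lambda>z. f z w) has_field_derivative f1 z w) (at z)"
    "\<And>z. z \<in> D \<Longrightarrow> ((\<lambda>z. f z z) has_derivative (\<lambda>h. h * f1 z z + cnj h * f2 z z)) (at z)"
    "sesqui D g1" "\<And>z w. z \<in> D \<Longrightarrow> w \<in> D \<Longrightarrow> ((\<lambda>z. g z w) has_field_derivative g1 z w) (at z)"
    "\<And>z. z \<in> D \<Longrightarrow> ((\<lambda>z. g z z) has_derivative (\<lambda>h. h * g1 z z + cnj h * g2 z z)) (at z)"
    by blast
  then show ?case
    by (intro exI[of _ "\<lambda>z w. f1 z w + g1 z w"] exI[of _ "\<lambda>z w. f2 z w + g2 z w"] conjI ballI)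
      (auto intro!: sesqui.add derivative_eq_intros has_derivative_eq_rhs[OF has_derivative_add] simp: algebra_simps)
next
  case (mult f g)
  then obtain f1 f2 g1 g2 where *:
    "sesqui D f1" "\<And>z w. z \<in> D \<Longrightarrow> w \<in> D \<Longrightarrow> ((\<lambda>z. f z w) has_field_derivative f1 z w) (at z)"
    "\<And>z. z \<in> D \<Longrightarrow> ((\<lambda>z. f z z) has_derivative (\<lambda>h. h * f1 z z + cnj h * f2 z z)) (at z)"
    "sesqui D g1" "\<And>z w. z \<in> D \<Longrightarrow> w \<in> D \<Longrightarrow> ((\<lambda>z. g z w) has_field_derivative g1 z w) (at z)"
    "\<And>z. z \<in> D \<Longrightarrow> ((\<lambda>z. g z z) has_derivative (\<lambda>h. h * g1 z z + cnj h * g2 z z)) (at z)"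
    by blast
  have "sesqui D (\<lambda>z w. f1 z w * g z w + g1 z w * f z w)"
    by (intro sesqui.add sesqui.mult mult.hyps *)
  moreover have "((\<lambda>z. f z z * g z z) has_derivative
      (\<lambda>h. h * (f1 z z * g z z + g1 z z * f z z) + cnj h * (f2 z z * g z z + g2 z z * f z z))) (at z)"
    if "z \<in> D" for z
    by (rule has_derivative_eq_rhs[OF has_derivative_mult[OF *(3,6)[OF that]]]) (auto simp: algebra_simps)
  ultimately show ?case using DERIV_mult[OF *(2,5)]
    by (intro exI[of _ "\<lambda>z w. f1 z w * g z w + g1 z w * f z w"]
        exI[of _ "\<lambda>z w. f2 z w * g z w + g2 z w * f z w"]) blast
qed

text \<open>Differentiating \<open>g z z = 0\<close> in the directions \<open>1\<close> and \<open>\<i>\<close> shows that the partial derivative of \<open>g\<close>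
  in its first argument vanishes on the diagonal as well, hence so do all higher ones.\<close>

lemma sesqui_polarization:
  assumes D: "open D" "connected D" and g: "sesqui D g" and diag: "\<And>z. z \<in> D \<Longrightarrow> g z z = 0"
    and "z \<in> D" "w \<in> D"
  shows "g z w = 0"
proof -
  \<comment> \<open>With \<open>w\<close> fixed, the expansion of \<open>g z w\<close> in
    \<open>z\<close> is taken at the diagonal point \<open>z = w\<close>.\<close>
  have "(deriv ^^ n) (\<lambda>z. g z w) w = 0" if "sesqui D g" "\<And>z. z \<in> D \<Longrightarrow> g z z = 0" for n g
    using that
  proof (induction n arbitrary: g)
    case 0
    then show ?case using \<open>w \<in> D\<close> by simp
  next
    case (Suc n)
    from sesqui_derivative[OF D(1) Suc.prems(1)] obtain g1 g2 where g1: "sesqui D g1"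
      "\<And>z w. z \<in> D \<Longrightarrow> w \<in> D \<Longrightarrow> ((\<lambda>z. g z w) has_field_derivative g1 z w) (at z)"
      "\<And>z. z \<in> D \<Longrightarrow> ((\<lambda>z. g z z) has_derivative (\<lambda>h. h * g1 z z + cnj h * g2 z z)) (at z)"
      by blast
    have "g1 z z = 0" if z: "z \<in> D" for z
    proof -
      have "((\<lambda>z. 0) has_derivative (\<lambda>h. h * g1 z z + cnj h * g2 z z)) (at z)"
        by (rule has_derivative_transform_within_open[OF g1(3)[OF z] D(1) z]) (rule Suc.prems(2))
      then have "(\<lambda>h. h * g1 z z + cnj h * g2 z z) = (\<lambda>h. 0)"
        by (rule has_derivative_unique) (rule has_derivative_const)
      from fun_cong[OF this, of 1] fun_cong[OF this, of \<i>]
      have "g1 z z + g2 z z = 0" "\<i> * (g1 z z - g2 z z) = 0" by (simp_all add: algebra_simps)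
      then show ?thesis by simp
    qed
    then have "(deriv ^^ n) (\<lambda>z. g1 z w) w = 0" by (intro Suc.IH g1)
    moreover have "(deriv ^^ n) (deriv (\<lambda>z. g z w)) w = (deriv ^^ n) (\<lambda>z. g1 z w) w"
      using eventually_nhds_in_open[OF D(1) \<open>w \<in> D\<close>]
      by (intro higher_deriv_cong_ev refl) (auto elim!: eventually_mono intro: DERIV_imp_deriv g1 \<open>w \<in> D\<close>)
    ultimately show ?case by (simp only: funpow_Suc_right o_apply)
  qed
  note vanish = this[OF g diag]
  have "(\<lambda>z. g z w) holomorphic_on D"
    using sesqui_derivative[OF D(1) g] \<open>w \<in> D\<close> D(1) by (metis holomorphic_on_open)
  from holomorphic_fun_eq_0_on_connected[OF this D vanish \<open>w \<in> D\<close> \<open>z \<in> D\<close>] show ?thesis .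
qed

section \<open>Hermitian forms along a disc\<close>

definition hform :: "('i::finite \<Rightarrow> real) \<Rightarrow> complex^'i \<Rightarrow> complex^'i \<Rightarrow> complex" where
  "hform e x y = (\<Sum>l\<in>UNIV. of_real (e l) * x $ l * cnj (y $ l))"

definition holo_vec :: "complex set \<Rightarrow> (complex \<Rightarrow> complex^'i) \<Rightarrow> (complex \<Rightarrow> complex^'i) \<Rightarrow> bool" where
  "holo_vec D V V' \<longleftrightarrow> (\<forall>z\<in>D. \<forall>l. ((\<lambda>z. V z $ l) has_field_derivative V' z $ l) (at z))"

lemma holo_vec_subset: "holo_vec D V V' \<Longrightarrow> E \<subseteq> D \<Longrightarrow> holo_vec E V V'"
  by (auto simp: holo_vec_def)

lemma hform_has_derivative_left:
  assumes "holo_vec D V V'" "z \<in> D"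
  shows "((\<lambda>z. hform e (V z) y) has_field_derivative hform e (V' z) y) (at z)"
  unfolding hform_def using assms unfolding holo_vec_def
  by (intro DERIV_sum DERIV_cmult_right DERIV_cmult) auto

lemma holo_vec_cnj:
  assumes "holo_vec D V V'" "cnj w \<in> D"
  shows "((\<lambda>w. cnj (V (cnj w) $ l)) has_field_derivative cnj (V' (cnj w) $ l)) (at w)"
proof -
  have "((\<lambda>z. V z $ l) has_field_derivative V' (cnj w) $ l) (at (cnj w))"
    using assms by (simp add: holo_vec_def)
  from has_field_derivative_cnj_cnj[OF this] show ?thesis by (simp add: o_def)
qed

lemma hform_has_derivative_right:
  assumes "holo_vec D V V'" "cnj w \<in> D"
  shows "((\<lambda>w. hform e x (V (cnj w))) has_field_derivative hform e x (V' (cnj w))) (at w)"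
  unfolding hform_def by (intro DERIV_sum DERIV_cmult holo_vec_cnj[OF assms])

lemma sesqui_hform:
  assumes D: "open D" and V: "holo_vec D V V'"
  shows "sesqui D (\<lambda>z w. hform e (V z) (V w))" "sesqui D (\<lambda>z w. hform e (V' z) (V w))"
    "sesqui D (\<lambda>z w. hform e (V z) (V' w))" "sesqui D (\<lambda>z w. hform e (V' z) (V' w))"
proof -
  have 1: "(\<lambda>z. V z $ l) holomorphic_on D" for l
    using V D unfolding holo_vec_def by (metis holomorphic_on_open)
  have "(\<lambda>z. V' z $ l) holomorphic_on D" for l
    by (rule holomorphic_transform[OF holomorphic_deriv[OF 1 D]])
      (use V in \<open>auto simp: holo_vec_def intro: DERIV_imp_deriv\<close>)
  then show "sesqui D (\<lambda>z w. hform e (V z) (V w))" "sesqui D (\<lambda>z w. hform e (V' z) (V w))"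
    "sesqui D (\<lambda>z w. hform e (V z) (V' w))" "sesqui D (\<lambda>z w. hform e (V' z) (V' w))"
    unfolding hform_def using 1 by (auto intro!: sesqui_sum sesqui.mult sesqui_const sesqui.antihol sesqui.hol
        holomorphic_on_mult holomorphic_on_const)
qed

text \<open>The factors of the normalized kernel, Calabi's diastasis in exponential form, in the holomorphic
  variable \<open>w\<close> that stands for the conjugate of the second argument.\<close>

definition left_factor :: "('i::finite \<Rightarrow> real) \<Rightarrow> (complex \<Rightarrow> complex^'i) \<Rightarrow> 'i \<Rightarrow> complex \<Rightarrow> complex" where
  "left_factor e V l z = of_real (e l) * V z $ l * (hform e (V 0) (V 0) / hform e (V z) (V 0))"

definition right_factor :: "('i::finite \<Rightarrow> real) \<Rightarrow> (complex \<Rightarrow> complex^'i) \<Rightarrow> 'i \<Rightarrow> complex \<Rightarrow> complex" where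
  "right_factor e V l w = cnj (V (cnj w) $ l) / hform e (V 0) (V (cnj w))"

text \<open>Dividing by the values on both axes removes the freedom of adding the real part of a
  holomorphic function to a potential, and makes the kernel \<open>1\<close> on the axes.\<close>

lemma sum_left_right_factor:
  "(\<Sum>l\<in>UNIV. left_factor e V l z * right_factor e V l w) =
    hform e (V z) (V (cnj w)) * hform e (V 0) (V 0) / (hform e (V z) (V 0) * hform e (V 0) (V (cnj w)))"
  unfolding left_factor_def right_factor_def
  by (subst (4) hform_def) (simp add: sum_distrib_left sum_distrib_right sum_divide_distrib mult_ac)

context
  fixes e :: "'i::finite \<Rightarrow> real" and V V' :: "complex \<Rightarrow> complex^'i" and r :: real
  assumes r: "r > 0" and V: "holo_vec (ball 0 r) V V'"
    and nz: "\<And>z w. z \<in> ball 0 r \<Longrightarrow> w \<in> ball 0 r \<Longrightarrow> hform e (V z) (V w) \<noteq> 0"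
begin

lemma right_factor_has_derivative:
  assumes w: "w \<in> ball 0 r"
  shows "(right_factor e V l has_field_derivative
      (cnj (V' (cnj w) $ l) * hform e (V 0) (V (cnj w)) - cnj (V (cnj w) $ l) * hform e (V 0) (V' (cnj w))) /
      (hform e (V 0) (V (cnj w)))\<^sup>2) (at w)"
proof -
  have cw: "cnj w \<in> ball 0 r" using w by simp
  have "hform e (V 0) (V (cnj w)) \<noteq> 0" using nz[OF _ cw, of 0] r by simp
  from DERIV_divide[OF holo_vec_cnj[OF V cw] hform_has_derivative_right[OF V cw] this]
  show ?thesis unfolding right_factor_def by (simp add: power2_eq_square)
qed

lemma right_factor_holomorphic: "right_factor e V l holomorphic_on ball 0 r"
  unfolding holomorphic_on_open[OF open_ball] using right_factor_has_derivative by blast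

lemma sum_left_right_factor_0: "z \<in> ball 0 r \<Longrightarrow> (\<Sum>l\<in>UNIV. left_factor e V l z * right_factor e V l 0) = 1"
  using nz[of z 0] nz[of 0 0] r by (simp add: sum_left_right_factor)

text \<open>Logarithmic derivative in \<open>w\<close>: of the four factors of the kernel, only the
  two that depend on \<open>w\<close> contribute.\<close>

lemma sum_left_deriv_right_factor:
  assumes z: "z \<in> ball 0 r" and w: "w \<in> ball 0 r"
  shows "(\<Sum>l\<in>UNIV. left_factor e V l z * deriv (right_factor e V l) w) =
    (\<Sum>l\<in>UNIV. left_factor e V l z * right_factor e V l w) *
    (hform e (V z) (V' (cnj w)) / hform e (V z) (V (cnj w)) - hform e (V 0) (V' (cnj w)) / hform e (V 0) (V (cnj w)))"
    (is "?L = _ * (?N2 / ?N - ?M2 / ?M)")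
proof -
  define C where "C = hform e (V 0) (V 0) / hform e (V z) (V 0)"
  have n: "?N \<noteq> 0" "?M \<noteq> 0" using nz r z w by simp_all
  have "?L = (\<Sum>l\<in>UNIV. (C / ?M) * (of_real (e l) * V z $ l * cnj (V' (cnj w) $ l)) -
       (C * ?M2 / ?M\<^sup>2) * (of_real (e l) * V z $ l * cnj (V (cnj w) $ l)))"
    using n by (intro sum.cong refl)
      (simp add: DERIV_imp_deriv[OF right_factor_has_derivative[OF w]] left_factor_def C_def[symmetric]
        field_simps power2_eq_square)
  also have "\<dots> = (C / ?M) * ?N2 - (C * ?M2 / ?M\<^sup>2) * ?N"
    by (simp only: sum_subtractf sum_distrib_left[symmetric] hform_def[symmetric])
  also have "\<dots> = (?N * C / ?M) * (?N2 / ?N - ?M2 / ?M)"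
    using n by (simp add: field_simps power2_eq_square)
  also have "?N * C / ?M = (\<Sum>l\<in>UNIV. left_factor e V l z * right_factor e V l w)"
    by (simp add: sum_left_right_factor C_def)
  finally show ?thesis .
qed

end

lemma hform_nonzero_near:
  assumes V: "holo_vec (ball 0 r) V V'" "r > 0" and nz: "hform e (V 0) (V 0) \<noteq> 0"
  obtains s where "s > 0" "s \<le> r" "\<And>z w. z \<in> ball 0 s \<Longrightarrow> w \<in> ball 0 s \<Longrightarrow> hform e (V z) (V w) \<noteq> 0"
proof -
  have c: "isCont (\<lambda>z. V z $ l) 0" for l
    using V unfolding holo_vec_def by (intro DERIV_isCont[of _ "V' 0 $ l"]) simp
  have c1: "isCont (\<lambda>p :: complex \<times> complex. V (fst p) $ l) (0, 0)" for l
    by (rule isCont_o2[where g = "\<lambda>z. V z $ l"]) (simp_all add: c)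
  have c2: "isCont (\<lambda>p :: complex \<times> complex. V (snd p) $ l) (0, 0)" for l
    by (rule isCont_o2[where g = "\<lambda>z. V z $ l"]) (simp_all add: c)
  have "isCont (\<lambda>p. hform e (V (fst p)) (V (snd p))) (0, 0)"
    unfolding hform_def by (intro continuous_intros c1 c2)
  from continuous_at_avoid[OF this, of 0] nz
  obtain t where t: "t > 0" "\<And>p. dist (0, 0) p < t \<Longrightarrow> hform e (V (fst p)) (V (snd p)) \<noteq> 0"
    by auto
  show thesis
  proof
    show "min r (t / 2) > 0" "min r (t / 2) \<le> r" using V t by auto
    fix z w :: complex assume "z \<in> ball 0 (min r (t / 2))" "w \<in> ball 0 (min r (t / 2))"
    then have "norm z + norm w < t" by simp
    moreover have "dist (0, 0) (z, w) \<le> norm z + norm w"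
      using sqrt_sum_squares_le_sum[of "norm z" "norm w"] by (simp add: dist_Pair_Pair)
    ultimately have "dist (0, 0) (z, w) < t" by linarith
    from t(2)[OF this] show "hform e (V z) (V w) \<noteq> 0" by simp
  qed
qed

section \<open>From isometric discs to the exponent\<close>

lemma exponent_of_isometric_discs:
  fixes V V' :: "complex \<Rightarrow> complex^'i::finite" and U U' :: "complex \<Rightarrow> complex^'j::finite" and a b :: real
  assumes r: "r > 0" and V: "holo_vec (ball 0 r) V V'" and U: "holo_vec (ball 0 r) U U'" and b: "b \<noteq> 0"
    and V0: "hform e (V 0) (V 0) \<noteq> 0" and U0: "hform d (U 0) (U 0) \<noteq> 0"
    and metric: "\<And>z. z \<in> ball 0 r \<Longrightarrow>
      of_real a * (hform e (V' z) (V' z) * hform e (V z) (V z) - hform e (V' z) (V z) * hform e (V z) (V' z))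
        * (hform d (U z) (U z))\<^sup>2 =
      of_real b * (hform d (U' z) (U' z) * hform d (U z) (U z) - hform d (U' z) (U z) * hform d (U z) (U' z))
        * (hform e (V z) (V z))\<^sup>2"
    and nontrivial: "hform e (V' 0) (V' 0) * hform e (V 0) (V 0) \<noteq> hform e (V' 0) (V 0) * hform e (V 0) (V' 0)"
  shows "\<exists>p q :: nat. q > 0 \<and> a / b = real p / real q"
proof -
  obtain s1 where s1: "s1 > 0" "s1 \<le> r" "\<And>z w. z \<in> ball 0 s1 \<Longrightarrow> w \<in> ball 0 s1 \<Longrightarrow> hform e (V z) (V w) \<noteq> 0"
    using hform_nonzero_near[OF V r V0] by metis
  obtain s2 where s2: "s2 > 0" "s2 \<le> r" "\<And>z w. z \<in> ball 0 s2 \<Longrightarrow> w \<in> ball 0 s2 \<Longrightarrow> hform d (U z) (U w) \<noteq> 0"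
    using hform_nonzero_near[OF U r U0] by metis
  define s where "s = min s1 s2"
  let ?D = "ball 0 s :: complex set"
  have s: "s > 0" "?D \<subseteq> ball 0 r" using s1 s2 by (auto simp: s_def)
  have VD: "holo_vec ?D V V'" and UD: "holo_vec ?D U U'" using V U s(2) by (blast intro: holo_vec_subset)+
  have Vnz: "hform e (V z) (V w) \<noteq> 0" and Unz: "hform d (U z) (U w) \<noteq> 0" if "z \<in> ?D" "w \<in> ?D" for z w
    using s1(3) s2(3) that by (auto simp: s_def)
  \<comment> \<open>The metric identity with denominators cleared, so that it lies in the class to
    which polarization applies.\<close>
  define E where "E z w =
      of_real a * (hform e (V' z) (V' w) * hform e (V z) (V w) - hform e (V' z) (V w) * hform e (V z) (V' w))
        * (hform d (U z) (U w) * hform d (U z) (U w)) -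
      of_real b * (hform d (U' z) (U' w) * hform d (U z) (U w) - hform d (U' z) (U w) * hform d (U z) (U' w))
        * (hform e (V z) (V w) * hform e (V z) (V w))" for z w
  have "sesqui ?D E"
    unfolding E_def by (intro sesqui_diff sesqui.mult sesqui_const sesqui_hform[OF open_ball VD] sesqui_hform[OF open_ball UD])
  moreover have "E z z = 0" if "z \<in> ?D" for z
    using metric[of z] that s(2) by (auto simp: E_def power2_eq_square)
  ultimately have E: "E z w = 0" if "z \<in> ?D" "w \<in> ?D" for z w
    using sesqui_polarization[OF open_ball connected_ball] that by blast
  \<comment> \<open>Up to a non-vanishing denominator, \<open>E\<close> is the
    \<open>z\<close>-derivative of \<open>\<psi>\<close>. So \<open>\<psi> z w = \<psi> 0 w\<close>,
    which is the relation between the logarithmic \<open>w\<close>-derivatives of the two normalized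
    kernels.\<close>
  define \<psi> where "\<psi> z w = of_real a * (hform e (V z) (V' w) / hform e (V z) (V w)) -
      of_real b * (hform d (U z) (U' w) / hform d (U z) (U w))" for z w
  have \<psi>: "\<psi> z w = \<psi> 0 w" if zw: "z \<in> ?D" "w \<in> ?D" for z w
  proof -
    have "((\<lambda>z. \<psi> z w) has_field_derivative 0) (at z)" if z: "z \<in> ?D" for z
    proof -
      let ?N = "hform e (V z) (V w)" and ?P = "hform d (U z) (U w)"
      have n: "?N \<noteq> 0" "?P \<noteq> 0" using Vnz Unz z zw by auto
      have "((\<lambda>z. \<psi> z w) has_field_derivative
         of_real a * ((hform e (V' z) (V' w) * ?N - hform e (V z) (V' w) * hform e (V' z) (V w)) / (?N * ?N)) -
         of_real b * ((hform d (U' z) (U' w) * ?P - hform d (U z) (U' w) * hform d (U' z) (U w)) / (?P * ?P))) (at z)"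
        unfolding \<psi>_def
        by (intro DERIV_diff DERIV_cmult DERIV_divide hform_has_derivative_left[OF VD z]
            hform_has_derivative_left[OF UD z] n)
      moreover have "of_real a * ((hform e (V' z) (V' w) * ?N - hform e (V z) (V' w) * hform e (V' z) (V w)) / (?N * ?N)) -
         of_real b * ((hform d (U' z) (U' w) * ?P - hform d (U z) (U' w) * hform d (U' z) (U w)) / (?P * ?P)) =
         E z w / (?N * ?N * (?P * ?P))"
        using n by (simp add: E_def divide_simps) (simp add: algebra_simps)
      ultimately show ?thesis using E[OF z zw(2)] by simp
    qed
    then show ?thesis
      using has_field_derivative_zero_constant[of ?D "\<lambda>z. \<psi> z w"] zw(1) s(1)
      by (metis DERIV_subset UNIV_I centre_in_ball convex_ball subsetI)
  qed
  \<comment> \<open>The algebra consists of functions on a whole type; \<open>\<rho>\<close> maps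
    the plane onto the disc, fixing the disc and sending all else to its centre.\<close>
  define \<rho> where "\<rho> z = (if z \<in> ?D then z else 0)" for z
  have \<rho>: "\<rho> z \<in> ?D" for z using s by (auto simp: \<rho>_def)
  let ?F = "\<lambda>l z. left_factor e V l (\<rho> z)" and ?K = "right_factor e V"
  let ?G = "\<lambda>l z. left_factor d U l (\<rho> z)" and ?M = "right_factor d U"
  \<comment> \<open>A continuous function of finite range on a connected set is constant. If this
    happened for every \<open>w1\<close>, the normalized kernel would be identically
    \<open>1\<close>; differentiating the resulting product formula in \<open>z\<close> and then in
    \<open>w\<close> at \<open>0\<close> contradicts \<open>nontrivial\<close>.\<close>
  have "\<exists>w1\<in>?D. infinite (range (\<lambda>z. \<Sum>l\<in>UNIV. ?F l z * ?K l w1))"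
  proof (rule ccontr)
    assume fin: "\<not> ?thesis"
    have prod: "hform e (V z) (V w) * hform e (V 0) (V 0) = hform e (V z) (V 0) * hform e (V 0) (V w)"
      if z: "z \<in> ?D" and w: "w \<in> ?D" for z w
    proof -
      define f where "f z = (\<Sum>l\<in>UNIV. left_factor e V l z * ?K l (cnj w))" for z
      have f: "f z = hform e (V z) (V w) * hform e (V 0) (V 0) / (hform e (V z) (V 0) * hform e (V 0) (V w))" for z
        by (simp add: f_def sum_left_right_factor)
      have "f ` ?D \<subseteq> range (\<lambda>z. \<Sum>l\<in>UNIV. ?F l z * ?K l (cnj w))"
        by (auto simp: f_def \<rho>_def intro!: image_eqI)
      moreover have "cnj w \<in> ?D" using w by simp
      ultimately have "finite (f ` ?D)" using fin finite_subset by blast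
      moreover have "continuous_on ?D f"
        using Vnz s(1) w hform_has_derivative_left[OF VD] unfolding f
        by (intro continuous_intros continuous_at_imp_continuous_on ballI DERIV_isCont) auto
      ultimately have "f constant_on ?D"
        using continuous_finite_range_constant[OF connected_ball] by blast
      then have "f z = f 0" using z s(1) by (force simp: constant_on_def)
      then show ?thesis
        using Vnz[OF z, of 0] Vnz[OF _ w, of 0] Vnz[of 0 0] s(1) by (simp add: f field_simps)
    qed
    have prod1: "hform e (V' 0) (V w) * hform e (V 0) (V 0) = hform e (V' 0) (V 0) * hform e (V 0) (V w)"
      if w: "w \<in> ?D" for w
    proof -
      have 0: "0 \<in> ?D" using s by simp
      have "((\<lambda>z. hform e (V z) (V 0) * hform e (V 0) (V w)) has_field_derivative
          hform e (V' 0) (V w) * hform e (V 0) (V 0)) (at 0)"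
        by (rule has_field_derivative_transform_within_open[OF
            DERIV_cmult_right[OF hform_has_derivative_left[OF VD 0]] open_ball 0]) (rule prod[OF _ w])
      then show ?thesis
        using DERIV_unique DERIV_cmult_right[OF hform_has_derivative_left[OF VD 0]] by blast
    qed
    have 0: "cnj 0 \<in> ?D" "(0::complex) \<in> ?D" using s by simp_all
    have "((\<lambda>w. hform e (V' 0) (V 0) * hform e (V 0) (V (cnj w))) has_field_derivative
          hform e (V' 0) (V' (cnj 0)) * hform e (V 0) (V 0)) (at 0)"
      by (rule has_field_derivative_transform_within_open[OF
            DERIV_cmult_right[OF hform_has_derivative_right[OF VD 0(1)]] open_ball 0(2)]) (intro prod1, simp)
    then have "hform e (V' 0) (V' (cnj 0)) * hform e (V 0) (V 0) = hform e (V' 0) (V 0) * hform e (V 0) (V' (cnj 0))"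
      using DERIV_unique DERIV_cmult[OF hform_has_derivative_right[OF VD 0(1)]] by blast
    with nontrivial show False by simp
  qed
  then obtain w1 where w1: "w1 \<in> ?D" "infinite (range (\<lambda>z. \<Sum>l\<in>UNIV. ?F l z * ?K l w1))" by blast
  have "\<exists>p q :: nat. q > 0 \<and> complex_of_real (a / b) = of_nat p / of_nat q"
  proof (rule finite_rank_power_exponent[where F = ?F and K = ?K and G = ?G and M = ?M, OF s(1) _ _ _ _ _ w1])
    show "?K l holomorphic_on ?D" for l by (rule right_factor_holomorphic[OF s(1) VD Vnz])
    show "?M l holomorphic_on ?D" for l by (rule right_factor_holomorphic[OF s(1) UD Unz])
    show "(\<Sum>l\<in>UNIV. ?F l z * ?K l 0) = 1" for z by (rule sum_left_right_factor_0[OF s(1) VD Vnz \<rho>])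
    show "(\<Sum>l\<in>UNIV. ?G l z * ?M l 0) = 1" for z by (rule sum_left_right_factor_0[OF s(1) UD Unz \<rho>])
    fix z w :: complex assume w: "w \<in> ?D"
    have cw: "cnj w \<in> ?D" using w by simp
    let ?n = "hform e (V (\<rho> z)) (V' (cnj w)) / hform e (V (\<rho> z)) (V (cnj w)) - hform e (V 0) (V' (cnj w)) / hform e (V 0) (V (cnj w))"
    let ?p = "hform d (U (\<rho> z)) (U' (cnj w)) / hform d (U (\<rho> z)) (U (cnj w)) - hform d (U 0) (U' (cnj w)) / hform d (U 0) (U (cnj w))"
    have "of_real a * ?n = of_real b * ?p"
      using \<psi>[OF \<rho> cw, of z] by (simp add: \<psi>_def algebra_simps)
    then have p: "?p = of_real (a / b) * ?n" using b by (simp add: field_simps)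
    have "(\<Sum>l\<in>UNIV. ?F l z * deriv (?K l) w) = (\<Sum>l\<in>UNIV. ?F l z * ?K l w) * ?n"
      by (rule sum_left_deriv_right_factor[OF s(1) VD Vnz \<rho> w])
    moreover have "(\<Sum>l\<in>UNIV. ?G l z * deriv (?M l) w) = (\<Sum>l\<in>UNIV. ?G l z * ?M l w) * ?p"
      by (rule sum_left_deriv_right_factor[OF s(1) UD Unz \<rho> w])
    ultimately show "of_real (a / b) * (\<Sum>l\<in>UNIV. ?F l z * deriv (?K l) w) * (\<Sum>l\<in>UNIV. ?G l z * ?M l w) =
        (\<Sum>l\<in>UNIV. ?F l z * ?K l w) * (\<Sum>l\<in>UNIV. ?G l z * deriv (?M l) w)"
      by (simp only: p ac_simps)
  qed
  then obtain p q :: nat where "q > 0" "complex_of_real (a / b) = of_real (real p / real q)" by auto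
  then show ?thesis unfolding of_real_eq_iff by blast
qed

section \<open>The Fubini-Study metric in homogeneous coordinates\<close>

definition fs_weight :: "real \<Rightarrow> 'n option \<Rightarrow> real" where
  "fs_weight b l = (case l of None \<Rightarrow> 1 | Some _ \<Rightarrow> b)"

text \<open>The linear part of the affine map \<open>affine_lift j\<close>, and thus its derivative
  at every point.\<close>

definition affine_dir :: "'n option \<Rightarrow> complex^'n::finite \<Rightarrow> 'n homogeneous" where
  "affine_dir j u = affine_lift j u - affine_lift j 0"

lemma affine_dir_nth:
  "affine_dir j u $ l = (if l = j then 0 else case l of None \<Rightarrow> u $ the j | Some i \<Rightarrow> u $ i)"
  by (auto simp: affine_dir_def affine_lift_def split: option.split)

lemma affine_lift_nth_self: "affine_lift j w $ j = 1"
  by (simp add: affine_lift_def)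

lemma affine_dir_add: "affine_dir j (u + v) = affine_dir j u + affine_dir j v"
  by (simp add: vec_eq_iff affine_dir_nth split: option.split)

lemma affine_dir_scale: "affine_dir j (c *s u) = c *s affine_dir j u"
  by (simp add: vec_eq_iff affine_dir_nth split: option.split)

lemma affine_dir_eq_0: "affine_dir j u = 0 \<longleftrightarrow> u = 0"
proof
  assume 0: "affine_dir j u = 0"
  have "u $ i = 0" for i
    using arg_cong[OF 0, of "\<lambda>v. v $ (if j = Some i then None else Some i)"]
    by (auto simp: affine_dir_nth split: if_splits)
  then show "u = 0" by (simp add: vec_eq_iff)
qed (simp add: vec_eq_iff affine_dir_nth split: option.split)

lemma bounded_linear_affine_dir: "bounded_linear (affine_dir j :: complex^'n::finite \<Rightarrow> _)"
proof (rule linear_conv_bounded_linear[THEN iffD1], rule linearI)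
  fix r :: real and x :: "complex^'n"
  show "affine_dir j (r *\<^sub>R x) = r *\<^sub>R affine_dir j x"
    by (simp add: vec_eq_iff affine_dir_nth split: option.split)
qed (rule affine_dir_add)

lemma affine_lift_has_derivative:
  assumes "(\<gamma> has_derivative \<gamma>') (at x within A)"
  shows "((\<lambda>x. affine_lift j (\<gamma> x)) has_derivative (\<lambda>h. affine_dir j (\<gamma>' h))) (at x within A)"
proof -
  have "((\<lambda>x. affine_dir j (\<gamma> x) + affine_lift j 0) has_derivative (\<lambda>h. affine_dir j (\<gamma>' h))) (at x within A)"
    using has_derivative_add[OF bounded_linear.has_derivative[OF bounded_linear_affine_dir assms]
        has_derivative_const[of "affine_lift j 0"]] by simp
  then show ?thesis by (simp add: affine_dir_def)
qed

lemma hform_cnj: "cnj (hform e x y) = hform e y x"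
  by (simp add: hform_def mult_ac)

lemma hform_scale: "hform e (c *s x) y = c * hform e x y" "hform e x (c *s y) = cnj c * hform e x y"
  by (simp_all add: hform_def sum_distrib_left mult_ac)

lemma hform_diff: "hform e (x - x') y = hform e x y - hform e x' y" "hform e x (y - y') = hform e x y - hform e x y'"
  by (simp_all add: hform_def sum_subtractf algebra_simps)

lemma hform_sum: "hform e (\<Sum>k\<in>K. x k) y = (\<Sum>k\<in>K. hform e (x k) y)" "hform e y (\<Sum>k\<in>K. x k) = (\<Sum>k\<in>K. hform e y (x k))"
  unfolding hform_def by (simp_all add: sum_distrib_left sum_distrib_right) (rule sum.swap)+

lemma hform_self: "hform e x x = of_real (\<Sum>l\<in>UNIV. e l * (norm (x $ l))\<^sup>2)"
  by (simp add: hform_def mult.assoc complex_norm_square[symmetric])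

lemma hform_has_derivative:
  assumes f: "(f has_derivative f') (at x within A)" and g: "(g has_derivative g') (at x within A)"
  shows "((\<lambda>x. hform e (f x) (g x)) has_derivative (\<lambda>h. hform e (f' h) (g x) + hform e (f x) (g' h))) (at x within A)"
proof -
  have "((\<lambda>x. of_real (e l) * f x $ l * cnj (g x $ l)) has_derivative
      (\<lambda>h. of_real (e l) * f' h $ l * cnj (g x $ l) + of_real (e l) * f x $ l * cnj (g' h $ l))) (at x within A)" for l
  proof -
    have "((\<lambda>x. f x $ l) has_derivative (\<lambda>h. f' h $ l)) (at x within A)"
      "((\<lambda>x. cnj (g x $ l)) has_derivative (\<lambda>h. cnj (g' h $ l))) (at x within A)"
      by (intro has_derivative_cnj bounded_linear.has_derivative[OF bounded_linear_vec_nth] f g)+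
    from has_derivative_mult[OF has_derivative_mult_right[OF this(1)] this(2)]
    show ?thesis by (rule has_derivative_eq_rhs) (simp add: fun_eq_iff algebra_simps)
  qed
  then have "((\<lambda>x. hform e (f x) (g x)) has_derivative
      (\<lambda>h. \<Sum>l\<in>UNIV. of_real (e l) * f' h $ l * cnj (g x $ l) + of_real (e l) * f x $ l * cnj (g' h $ l))) (at x within A)"
    unfolding hform_def by (intro has_derivative_sum)
  then show ?thesis by (simp add: hform_def sum.distrib)
qed

lemma projective_potential_hform:
  "projective_potential b j x = ln (Re (hform (fs_weight b) (affine_lift j x) (affine_lift j x))) / b"
proof -
  have "(\<Sum>l\<in>UNIV. fs_weight b l * (norm (v $ l))\<^sup>2) =
      (norm (v $ None))\<^sup>2 + b * (\<Sum>i\<in>UNIV. (norm (v $ Some i))\<^sup>2)" for v :: "'a homogeneous"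
    by (simp add: UNIV_option_conv sum.insert sum.reindex fs_weight_def sum_distrib_left image_iff)
  then show ?thesis by (simp add: projective_potential_def hform_self Let_def)
qed

text \<open>This is the mixed second derivative of \<open>ln q\<close>, namely
  \<open>(q q_{z,zbar} - q_z q_zbar) / q^2\<close>, for a Hermitian form \<open>q\<close> evaluated
  on an affine lift. Positivity is required on an open set because the first derivative must be
  known near \<open>z\<close> before it is differentiated again.\<close>

lemma potential_metric_projective:
  assumes b: "b \<noteq> 0" and W: "open W" and z: "z \<in> W"
    and pos: "\<And>x. x \<in> W \<Longrightarrow> Re (hform (fs_weight b) (affine_lift j x) (affine_lift j x)) > 0"
  shows "potential_metric (projective_potential b j) z u v =
    (hform (fs_weight b) (affine_dir j u) (affine_dir j v) * hform (fs_weight b) (affine_lift j z) (affine_lift j z)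
      - hform (fs_weight b) (affine_dir j u) (affine_lift j z) * hform (fs_weight b) (affine_lift j z) (affine_dir j v))
    / (of_real b * (hform (fs_weight b) (affine_lift j z) (affine_lift j z))\<^sup>2)"
proof -
  let ?f = "hform (fs_weight b)"
  let ?\<phi> = "\<lambda>x. complex_of_real (projective_potential b j x)"
  define Y where "Y x = affine_lift j x" for x
  define \<Delta> where "\<Delta> = affine_dir j"
  define q where "q x = Re (?f (Y x) (Y x))" for x
  have fq: "?f (Y x) (Y x) = of_real (q x)" for x by (simp add: q_def hform_self)
  have qpos: "q x > 0" if "x \<in> W" for x using pos[OF that] by (simp add: q_def Y_def)
  \<comment> \<open>Complex linearity of \<open>\<Delta>\<close> is what lets the Wirtinger
    operators separate the linear from the antilinear half of a real derivative.\<close>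
  have \<Delta>i: "\<Delta> (axis i \<i>) = \<i> *s \<Delta> (axis i 1)" for i
    unfolding \<Delta>_def affine_dir_scale[symmetric] by (rule arg_cong[of _ _ "affine_dir j"]) (auto simp: axis_def vec_eq_iff)
  have Y': "(Y has_derivative \<Delta>) (at x)" for x
    unfolding Y_def \<Delta>_def by (rule affine_lift_has_derivative[OF has_derivative_ident])
  have ff': "((\<lambda>x. ?f (Y x) (Y x)) has_derivative (\<lambda>h. ?f (\<Delta> h) (Y x) + ?f (Y x) (\<Delta> h))) (at x)" for x
    by (rule hform_has_derivative[OF Y' Y'])
  have q': "(q has_derivative (\<lambda>h. 2 * Re (?f (\<Delta> h) (Y x)))) (at x)" for x
  proof -
    have "Re (?f (Y x) (\<Delta> h)) = Re (?f (\<Delta> h) (Y x))" for h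
      using hform_cnj[of "fs_weight b" "\<Delta> h" "Y x"] by (metis complex_cnj(1) cnj.simps(1))
    with has_derivative_Re[OF ff'[of x]] show ?thesis unfolding q_def by simp
  qed
  have bar: "wirtinger_bar i ?\<phi> x = ?f (Y x) (\<Delta> (axis i 1)) / (of_real b * ?f (Y x) (Y x))"
    if x: "x \<in> W" for i x
  proof -
    have log: "((\<lambda>x. ln (q x) / b) has_derivative (\<lambda>h. 2 * Re (?f (\<Delta> h) (Y x)) / (q x * b))) (at x)"
    proof -
      have "(ln has_derivative (\<lambda>h. inverse (q x) * h)) (at (q x))"
        using DERIV_ln[OF qpos[OF x]] by (simp add: has_field_derivative_def)
      from has_derivative_compose[OF q' this]
      have "((\<lambda>x. ln (q x)) has_derivative (\<lambda>h. inverse (q x) * (2 * Re (?f (\<Delta> h) (Y x))))) (at x)" .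
      from has_derivative_mult_left[OF this, of "inverse b"]
      show ?thesis by (simp add: field_simps)
    qed
    have "(?\<phi> has_derivative (\<lambda>h. of_real (2 * Re (?f (\<Delta> h) (Y x)) / (q x * b)))) (at x)"
      using has_derivative_of_real[OF log, where ?'a = complex]
      by (simp only: projective_potential_hform q_def Y_def)
    then have "frechet_derivative ?\<phi> (at x) = (\<lambda>h. of_real (2 * Re (?f (\<Delta> h) (Y x)) / (q x * b)))"
      by (rule frechet_derivative_at[symmetric])
    then have "wirtinger_bar i ?\<phi> x = cnj (?f (\<Delta> (axis i 1)) (Y x)) / (of_real b * of_real (q x))"
      using b qpos[OF x] unfolding wirtinger_bar_def
      by (simp add: \<Delta>i hform_scale complex_eq_iff field_simps)
    then show ?thesis by (simp add: hform_cnj fq)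
  qed
  have mix: "wirtinger k (wirtinger_bar i ?\<phi>) z =
      (?f (\<Delta> (axis k 1)) (\<Delta> (axis i 1)) * ?f (Y z) (Y z) - ?f (\<Delta> (axis k 1)) (Y z) * ?f (Y z) (\<Delta> (axis i 1)))
      / (of_real b * (?f (Y z) (Y z))\<^sup>2)" for k i
  proof -
    let ?Q = "?f (Y z) (Y z)" and ?d = "\<Delta> (axis i 1)"
    define G where "G h = (?f (\<Delta> h) ?d * ?Q - ?f (Y z) ?d * (?f (\<Delta> h) (Y z) + ?f (Y z) (\<Delta> h)))
        / (of_real b * ?Q\<^sup>2)" for h
    have Q: "?Q \<noteq> 0" using qpos[OF z] by (simp add: fq)
    have "((\<lambda>x. ?f (Y x) ?d) has_derivative (\<lambda>h. ?f (\<Delta> h) ?d)) (at z)"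
      using hform_has_derivative[OF Y' has_derivative_const[of ?d], of "fs_weight b"] by (simp add: hform_def)
    moreover have "((\<lambda>x. of_real b * ?f (Y x) (Y x)) has_derivative
        (\<lambda>h. of_real b * (?f (\<Delta> h) (Y z) + ?f (Y z) (\<Delta> h)))) (at z)"
      by (rule has_derivative_mult_right[OF ff'])
    ultimately have "((\<lambda>x. ?f (Y x) ?d / (of_real b * ?f (Y x) (Y x))) has_derivative G) (at z)"
      using Q b by (intro has_derivative_eq_rhs[OF has_derivative_divide])
        (auto simp: G_def fun_eq_iff field_simps power2_eq_square)
    then have "(wirtinger_bar i ?\<phi> has_derivative G) (at z)"
      by (rule has_derivative_transform_within_open[OF _ W z]) (simp add: bar)
    then have "frechet_derivative (wirtinger_bar i ?\<phi>) (at z) = G"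
      by (rule frechet_derivative_at[symmetric])
    then have "wirtinger k (wirtinger_bar i ?\<phi>) z = (G (axis k 1) - \<i> * G (axis k \<i>)) / 2"
      by (simp add: wirtinger_def)
    also have "\<dots> = (?f (\<Delta> (axis k 1)) ?d * ?Q - ?f (Y z) ?d * ?f (\<Delta> (axis k 1)) (Y z)) / (of_real b * ?Q\<^sup>2)"
      unfolding G_def \<Delta>i hform_scale using Q b by (simp add: field_simps)
    finally show ?thesis by (simp add: mult.commute)
  qed
  have expand: "\<Delta> u = (\<Sum>k\<in>UNIV. u $ k *s \<Delta> (axis k 1))" for u
  proof -
    have "linear \<Delta>" unfolding \<Delta>_def by (rule bounded_linear.linear[OF bounded_linear_affine_dir])
    then have "\<Delta> (\<Sum>k\<in>UNIV. u $ k *s axis k 1) = (\<Sum>k\<in>UNIV. \<Delta> (u $ k *s axis k 1))"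
      by (rule linear_sum)
    then show ?thesis by (simp add: basis_expansion \<Delta>_def affine_dir_scale)
  qed
  have exp2: "?f (\<Delta> u) (\<Delta> v) = (\<Sum>k\<in>UNIV. \<Sum>i\<in>UNIV. ?f (\<Delta> (axis k 1)) (\<Delta> (axis i 1)) * u $ k * cnj (v $ i))"
    "?f (\<Delta> u) (Y z) = (\<Sum>k\<in>UNIV. ?f (\<Delta> (axis k 1)) (Y z) * u $ k)"
    "?f (Y z) (\<Delta> v) = (\<Sum>i\<in>UNIV. ?f (Y z) (\<Delta> (axis i 1)) * cnj (v $ i))"
    unfolding expand[of u] expand[of v] hform_sum hform_scale
    by (subst sum.swap, simp_all add: sum_distrib_left mult_ac)
  have "potential_metric (projective_potential b j) z u v =
      (\<Sum>k\<in>UNIV. \<Sum>i\<in>UNIV. (?f (\<Delta> (axis k 1)) (\<Delta> (axis i 1)) * u $ k * cnj (v $ i) * ?f (Y z) (Y z)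
        - (?f (\<Delta> (axis k 1)) (Y z) * u $ k) * (?f (Y z) (\<Delta> (axis i 1)) * cnj (v $ i))) / (of_real b * (?f (Y z) (Y z))\<^sup>2))"
    unfolding potential_metric_def mix by (intro sum.cong refl) (simp add: algebra_simps diff_divide_distrib)
  also have "\<dots> = (?f (\<Delta> u) (\<Delta> v) * ?f (Y z) (Y z) - ?f (\<Delta> u) (Y z) * ?f (Y z) (\<Delta> v)) / (of_real b * (?f (Y z) (Y z))\<^sup>2)"
    unfolding exp2 sum_product by (simp add: sum_divide_distrib[symmetric] sum_subtractf sum_distrib_right)
  finally show ?thesis by (simp add: Y_def \<Delta>_def)
qed

text \<open>A common description of both signs of \<open>b\<close>. For \<open>b < 0\<close> the
  index is fixed because there the form is negative on tangent directions only if these have no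
  \<open>None\<close> component.\<close>

lemma fubini_study_chart:
  fixes c :: "('n::finite homogeneous set, 'n) hchart"
  assumes c: "c \<in> fubini_study b" and b: "b \<noteq> 0"
  shows "\<exists>j. model c = UNIV \<and> open (pdom c) \<and> herm c = potential_metric (projective_potential b j) \<and>
    (b < 0 \<longrightarrow> j = None) \<and>
    (\<forall>z\<in>pdom c. Re (hform (fs_weight b) (affine_lift j z) (affine_lift j z)) > 0)"
proof (cases "b > 0")
  case True
  then obtain j where j: "c = projective_chart b j" using c by (auto simp: fubini_study_def)
  have "Re (hform (fs_weight b) (affine_lift j z) (affine_lift j z)) > 0" for z
  proof -
    have "(\<Sum>l\<in>UNIV. fs_weight b l * (norm (affine_lift j z $ l))\<^sup>2) > 0"
      using True by (intro sum_pos2[of _ j]) (auto simp: affine_lift_nth_self fs_weight_def split: option.split)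
    then show ?thesis by (simp add: hform_self)
  qed
  then show ?thesis using True unfolding j by (intro exI[of _ j]) (simp add: projective_chart_def)
next
  case False
  then have neg: "b < 0" using b by simp
  have cb: "c = ball_chart b" using c False by (simp add: fubini_study_def)
  have pot: "projective_potential b None = (\<lambda>Z :: complex^'n. ln (1 + b * (norm Z)\<^sup>2) / b)"
    by (simp add: fun_eq_iff projective_potential_None)
  have "Re (hform (fs_weight b) (affine_lift None Z) (affine_lift None Z)) = 1 + b * (norm Z)\<^sup>2" for Z :: "complex^'n"
    by (simp add: hform_self UNIV_option_conv sum.reindex fs_weight_def affine_lift_def image_iff
        norm_vec_def L2_set_def sum_nonneg sum_distrib_left)
  moreover have "1 + b * (norm Z)\<^sup>2 > 0" if "(norm Z)\<^sup>2 < - 1 / b" for Z :: "complex^'n"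
    using that neg by (simp add: field_simps)
  moreover have "open {Z :: complex^'n. (norm Z)\<^sup>2 < - 1 / b}"
    by (intro open_Collect_less continuous_intros)
  ultimately show ?thesis unfolding cb by (intro exI[of _ None]) (simp add: ball_chart_def pot)
qed

text \<open>For \<open>b > 0\<close> equality would be the equality case of Cauchy-Schwarz, making
  the direction \<open>d\<close> a multiple of the lift \<open>v\<close>; but their coordinates at
  \<open>j\<close> are \<open>0\<close> and \<open>1\<close>. For \<open>b < 0\<close> the form is
  negative at \<open>d\<close> and positive at \<open>v\<close>, so the left side is negative while
  the right side is a squared norm.\<close>

lemma hform_fs_nondegenerate:
  fixes u z :: "complex^'n::finite"
  assumes b: "b \<noteq> 0" "b < 0 \<longrightarrow> j = None" and u: "u \<noteq> 0"
    and pos: "Re (hform (fs_weight b) (affine_lift j z) (affine_lift j z)) > 0"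
  shows "hform (fs_weight b) (affine_dir j u) (affine_dir j u) * hform (fs_weight b) (affine_lift j z) (affine_lift j z) \<noteq>
    hform (fs_weight b) (affine_dir j u) (affine_lift j z) * hform (fs_weight b) (affine_lift j z) (affine_dir j u)"
proof
  let ?f = "hform (fs_weight b)"
  define d where "d = affine_dir j u"
  define v where "v = affine_lift j z"
  define q where "q = Re (?f v v)"
  have q: "q > 0" "?f v v = of_real q" using pos by (simp_all add: q_def v_def hform_self)
  have d0: "d \<noteq> 0" using u by (simp add: d_def affine_dir_eq_0)
  have dj: "d $ j = 0" by (simp add: d_def affine_dir_nth)
  have cs: "?f v d = cnj (?f d v)" by (simp add: hform_cnj)
  assume "?f (affine_dir j u) (affine_dir j u) * ?f (affine_lift j z) (affine_lift j z) =
    ?f (affine_dir j u) (affine_lift j z) * ?f (affine_lift j z) (affine_dir j u)"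
  then have eq: "?f d d * ?f v v = ?f d v * ?f v d" by (simp add: d_def v_def)
  show False
  proof (cases "b > 0")
    case True
    then have w: "fs_weight b l > 0" for l :: "'n option" by (simp add: fs_weight_def split: option.split)
    define t where "t = ?f d v / ?f v v"
    define x where "x = d - t *s v"
    have "?f x x = ?f d d - t * ?f v d - cnj t * (?f d v - t * ?f v v)"
      by (simp add: x_def hform_diff hform_scale algebra_simps)
    also have "t * ?f v v = ?f d v" using q by (simp add: t_def)
    also have "?f d d - t * ?f v d = 0"
      using eq q by (simp add: t_def field_simps)
    finally have "?f x x = 0" by simp
    then have "complex_of_real (\<Sum>l\<in>UNIV. fs_weight b l * (norm (x $ l))\<^sup>2) = 0" by (simp only: hform_self)
    then have "(\<Sum>l\<in>UNIV. fs_weight b l * (norm (x $ l))\<^sup>2) = 0" by (simp only: of_real_eq_0_iff)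
    then have x0: "x $ l = 0" for l
      using w by (subst (asm) sum_nonneg_eq_0_iff) (auto intro: less_imp_le simp: less_le)
    have "t = 0" using x0[of j] by (simp add: x_def dj v_def affine_lift_nth_self)
    then have "d = 0" using x0 by (simp add: x_def vec_eq_iff)
    with d0 show False by simp
  next
    case False
    then have neg: "b < 0" and j: "j = None" using b by auto
    have "Re (?f d d) < 0"
    proof -
      obtain l where l: "d $ l \<noteq> 0" using d0 by (auto simp: vec_eq_iff)
      have w: "fs_weight b l * (norm (d $ l))\<^sup>2 \<le> 0" for l
        using dj neg by (cases l) (auto simp: j fs_weight_def mult_nonpos_nonneg)
      have "(\<Sum>l\<in>UNIV. - (fs_weight b l * (norm (d $ l))\<^sup>2)) > 0"
        using l dj neg w by (cases l; intro sum_pos2[of _ l]) (auto simp: j fs_weight_def mult_less_0_iff)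
      then show ?thesis by (simp add: hform_self sum_negf)
    qed
    then have "Re (?f d d * ?f v v) < 0" using q by (simp add: mult_neg_pos)
    moreover have "Re (?f d v * ?f v d) \<ge> 0" by (simp add: cs)
    ultimately show False by (simp add: eq)
  qed
qed

section \<open>Discs in common submanifolds\<close>

lemma has_cderiv_at_open: "has_cderiv f D z A \<Longrightarrow> open A \<Longrightarrow> z \<in> A \<Longrightarrow> (f has_derivative D) (at z)"
  unfolding has_cderiv_def by (metis at_within_open)

lemma has_cderiv_scale: "has_cderiv f D z A \<Longrightarrow> D (c *s u) = c *s D u"
  unfolding has_cderiv_def Vector_Spaces.linear_iff by blast

lemma line_has_derivative:
  fixes w u :: "complex^'n"
  shows "((\<lambda>z. w + z *s u) has_derivative (\<lambda>t. t *s u)) (at z within A)"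
proof -
  have "bounded_linear (\<lambda>t :: complex. t *s u)"
    by (rule linear_conv_bounded_linear[THEN iffD1], rule linearI)
      (simp_all add: vec_eq_iff distrib_right)
  from has_derivative_add[OF has_derivative_const[of w] bounded_linear_imp_has_derivative[OF this]]
  show ?thesis by simp
qed

definition isometric_discs ::
  "('p, 'n::finite) hchart \<Rightarrow> ('q, 'm::finite) hchart \<Rightarrow> real \<Rightarrow> (complex \<Rightarrow> complex^'n) \<Rightarrow>
    (complex \<Rightarrow> complex^'n) \<Rightarrow> (complex \<Rightarrow> complex^'m) \<Rightarrow> (complex \<Rightarrow> complex^'m) \<Rightarrow> bool"
  where "isometric_discs c d r \<gamma> \<gamma>' \<delta> \<delta>' \<longleftrightarrow> r > 0 \<and> \<gamma>' 0 \<noteq> 0 \<and>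
    (\<forall>z\<in>ball 0 r. \<gamma> z \<in> pdom c \<and> \<delta> z \<in> pdom d \<and>
      (\<gamma> has_derivative (\<lambda>t. t *s \<gamma>' z)) (at z) \<and> (\<delta> has_derivative (\<lambda>t. t *s \<delta>' z)) (at z) \<and>
      herm c (\<gamma> z) (\<gamma>' z) (\<gamma>' z) = herm d (\<delta> z) (\<delta>' z) (\<delta>' z))"

text \<open>Positive dimension gives a complex line in the slice of the first submanifold. A small
  disc in it is carried into one space by \<open>\<beta>\<close>, and into the other by the isometry
  followed by \<open>\<beta>2\<close>.\<close>

lemma relatives_isometric_discs:
  fixes M :: "('p, 'n::finite) atlas" and N :: "('q, 'm::finite) atlas"
  assumes rel: "relatives M N" and MU: "\<And>c. c \<in> M \<Longrightarrow> model c = UNIV" and NU: "\<And>d. d \<in> N \<Longrightarrow> model d = UNIV"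
  obtains c d \<gamma> \<gamma>' \<delta> \<delta>' r where "c \<in> M" "d \<in> N" "isometric_discs c d r \<gamma> \<gamma>' \<delta> \<delta>'"
proof -
  obtain k S T where k: "k \<ge> 1" and S: "complex_submanifold M k S"
    and iso: "biholomorphically_isometric (induced M k S) (induced N k T)"
    using rel unfolding relatives_def by blast
  obtain f where f: "bij_betw f (points (induced M k S)) (points (induced N k T))"
    "holomorphic_map (induced M k S) (induced N k T) f" "preserves_metric (induced M k S) (induced N k T) f"
    using iso unfolding biholomorphically_isometric_def by blast
  obtain p where p: "p \<in> S" using S unfolding complex_submanifold_def by blast
  then obtain c \<beta> W L where ad: "adapted M k S c \<beta> W L" and "p \<in> (param c \<circ> \<beta>) ` W"
    using S unfolding complex_submanifold_def by blast
  then obtain w0 where w0: "w0 \<in> W" "p = param c (\<beta> w0)" by auto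
  define C where "C = slice_chart c \<beta> W L"
  have CM: "C \<in> induced M k S" unfolding C_def induced_def using ad by blast
  have c: "c \<in> M" using ad by (simp add: adapted_def)
  have w0L: "w0 \<in> L" using ad w0 p by (auto simp: adapted_def)
  have pC: "p \<in> cimage C" using w0 w0L by (auto simp: cimage_def C_def slice_chart_def)
  then have "p \<in> points (induced M k S)" using CM by (auto simp: points_def)
  then have "f p \<in> points (induced N k T)" using f(1) by (auto simp: bij_betw_def)
  then obtain D where DN: "D \<in> induced N k T" and fpD: "f p \<in> cimage D" by (auto simp: points_def)
  then obtain d \<beta>2 W2 L2 where D: "D = slice_chart d \<beta>2 W2 L2" and ad2: "adapted N k T d \<beta>2 W2 L2"
    unfolding induced_def by blast
  have d: "d \<in> N" using ad2 by (simp add: adapted_def)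
  define \<Omega> where "\<Omega> = local_dom f C D"
  define rep where "rep = local_rep f C D"
  have modC: "model C = L" "pdom C = W \<inter> L" by (simp_all add: C_def slice_chart_def)
  have \<Omega>: "openin (top_of_set L) \<Omega>" "hol_on rep \<Omega>"
  proof -
    have "openin (top_of_set (model C)) (local_dom f C D) \<and> hol_on (local_rep f C D) (local_dom f C D)"
      using f(2) CM DN unfolding holomorphic_map_def by blast
    then show "openin (top_of_set L) \<Omega>" "hol_on rep \<Omega>" by (simp_all add: modC \<Omega>_def rep_def)
  qed
  have \<Omega>sub: "\<Omega> \<subseteq> W \<inter> L" using modC by (auto simp: \<Omega>_def local_dom_def)
  have w0\<Omega>: "w0 \<in> \<Omega>"
    using w0 w0L fpD by (simp add: \<Omega>_def local_dom_def modC) (simp add: C_def slice_chart_def)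
  obtain R where R: "\<And>x. x \<in> \<Omega> \<Longrightarrow> has_cderiv rep (R x) x \<Omega>"
    using bchoice[OF \<Omega>(2)[unfolded hol_on_def]] by blast
  have rep_in: "rep x \<in> W2 \<inter> L2" if "x \<in> \<Omega>" for x
  proof -
    have "f (param C x) \<in> param D ` pdom D" using that by (simp add: \<Omega>_def local_dom_def cimage_def)
    then have "rep x \<in> pdom D" unfolding rep_def local_rep_def coords_def by (rule inv_into_into)
    then show ?thesis by (simp add: D slice_chart_def)
  qed
  have bih: "biholomorphism_onto_image UNIV \<beta> W" and bW: "\<beta> ` W \<subseteq> pdom c" and L: "vec.subspace L" "vec.dim L = k"
    using ad MU[OF c] by (simp_all add: adapted_def)
  have bih2: "biholomorphism_onto_image UNIV \<beta>2 W2" and bW2: "\<beta>2 ` W2 \<subseteq> pdom d"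
    using ad2 NU[OF d] by (simp_all add: adapted_def)
  have W: "open W" "open (\<beta> ` W)" "inj_on \<beta> W" "hol_on \<beta> W" "hol_on (inv_into W \<beta>) (\<beta> ` W)"
    and W2: "open W2" "hol_on \<beta>2 W2"
    using bih bih2 by (simp_all add: biholomorphism_onto_image_def)
  \<comment> \<open>The same choice of derivative as in \<open>slice_chart\<close>, so that the
    induced metrics unfold to \<open>herm c\<close> and \<open>herm d\<close> on the
    velocities.\<close>
  define B where "B w = (SOME D. has_cderiv \<beta> D w W)" for w
  define B2 where "B2 w = (SOME D. has_cderiv \<beta>2 D w W2)" for w
  have B: "has_cderiv \<beta> (B w) w W" if "w \<in> W" for w
    unfolding B_def by (rule someI_ex[where P = "\<lambda>D. has_cderiv \<beta> D w W"])
      (use W(4) that in \<open>auto simp: hol_on_def\<close>)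
  have B2: "has_cderiv \<beta>2 (B2 w) w W2" if "w \<in> W2" for w
    unfolding B2_def by (rule someI_ex[where P = "\<lambda>D. has_cderiv \<beta>2 D w W2"])
      (use W2(2) that in \<open>auto simp: hol_on_def\<close>)
  have "\<not> L \<subseteq> {0}" using L(2) k vec.dim_eq_0[of L] by simp
  then obtain u where u: "u \<in> L" "u \<noteq> 0" by blast
  obtain O' where O': "open O'" "\<Omega> = L \<inter> O'" using \<Omega>(1) unfolding openin_open by blast
  define x where "x z = w0 + z *s u" for z
  have x': "(x has_derivative (\<lambda>t. t *s u)) (at z within A)" for z A
    unfolding x_def by (rule line_has_derivative)
  have "continuous_on UNIV x"
    using x' by (intro continuous_at_imp_continuous_on ballI has_derivative_continuous)
  then have "open (x -` O')" using O'(1) by (simp add: open_vimage)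
  moreover have "0 \<in> x -` O'" using w0\<Omega> O' by (simp add: x_def)
  ultimately obtain r where r: "r > 0" "ball 0 r \<subseteq> x -` O'" using open_contains_ball by metis
  have xL: "x z \<in> L" for z unfolding x_def using L(1) u(1) w0L by (intro vec.subspace_add vec.subspace_scale)
  have x\<Omega>: "x z \<in> \<Omega>" if "z \<in> ball 0 r" for z using r that xL by (auto simp: O')
  have xW: "x z \<in> W" if "z \<in> ball 0 r" for z using x\<Omega>[OF that] \<Omega>sub by blast
  have "isometric_discs c d r (\<lambda>z. \<beta> (x z)) (\<lambda>z. B (x z) u)
    (\<lambda>z. \<beta>2 (rep (x z))) (\<lambda>z. B2 (rep (x z)) (R (x z) u))"
    unfolding isometric_discs_def
  proof (intro conjI ballI)
    show "r > 0" by fact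
    \<comment> \<open>The derivative of \<open>\<beta>\<close> at \<open>w0\<close> is injective
      because \<open>\<beta>\<close> has a differentiable inverse.\<close>
    show "B (x 0) u \<noteq> 0"
    proof
      assume 0: "B (x 0) u = 0"
      have x0: "x 0 = w0" by (simp add: x_def)
      obtain J where J: "has_cderiv (inv_into W \<beta>) J (\<beta> w0) (\<beta> ` W)"
        using W(5) w0(1) unfolding hol_on_def by blast
      have "((\<lambda>w. inv_into W \<beta> (\<beta> w)) has_derivative (\<lambda>h. J (B w0 h))) (at w0)"
        using has_derivative_compose[OF has_cderiv_at_open[OF B[OF w0(1)] W(1) w0(1)]
            has_cderiv_at_open[OF J W(2) imageI[OF w0(1)]]] .
      then have "((\<lambda>w. w) has_derivative (\<lambda>h. J (B w0 h))) (at w0)"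
        by (rule has_derivative_transform_within_open[OF _ W(1) w0(1)]) (simp add: inv_into_f_f W(3))
      then have "(\<lambda>h. J (B w0 h)) = (\<lambda>h. h)" by (rule has_derivative_unique) (rule has_derivative_ident)
      then have "J (B w0 u) = u" by (rule fun_cong)
      moreover have "J 0 = 0" using has_cderiv_scale[OF J, of 0 0] by simp
      ultimately show False using 0 u(2) by (simp add: x0)
    qed
    fix z :: complex assume z: "z \<in> ball 0 r"
    show "\<beta> (x z) \<in> pdom c" using bW xW[OF z] by blast
    show "\<beta>2 (rep (x z)) \<in> pdom d" using bW2 rep_in[OF x\<Omega>[OF z]] by blast
    have "((\<lambda>z. \<beta> (x z)) has_derivative (\<lambda>t. B (x z) (t *s u))) (at z)"
      by (rule has_derivative_compose[OF x' has_cderiv_at_open[OF B[OF xW[OF z]] W(1) xW[OF z]]])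
    then show "((\<lambda>z. \<beta> (x z)) has_derivative (\<lambda>t. t *s B (x z) u)) (at z)"
      by (simp add: has_cderiv_scale[OF B[OF xW[OF z]]])
    \<comment> \<open>\<open>rep\<close> is differentiable only within \<open>\<Omega>\<close>,
      which is open merely relative to \<open>L\<close>; the chain rule is applied within the image
      of the disc, which lies in \<open>\<Omega>\<close>.\<close>
    have "(rep has_derivative R (x z)) (at (x z) within x ` ball 0 r)"
      using R[OF x\<Omega>[OF z]] x\<Omega> by (auto simp: has_cderiv_def intro: has_derivative_subset)
    from has_derivative_in_compose[OF x' this]
    have rx: "((\<lambda>z. rep (x z)) has_derivative (\<lambda>t. R (x z) (t *s u))) (at z)"
      using z by (simp add: at_within_open[OF _ open_ball])
    have W2in: "rep (x z) \<in> W2" using rep_in[OF x\<Omega>[OF z]] by blast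
    have "((\<lambda>z. \<beta>2 (rep (x z))) has_derivative (\<lambda>t. B2 (rep (x z)) (R (x z) (t *s u)))) (at z)"
      by (rule has_derivative_compose[of "\<lambda>z. rep (x z)", OF rx has_cderiv_at_open[OF B2[OF W2in] W2(1) W2in]])
    then show "((\<lambda>z. \<beta>2 (rep (x z))) has_derivative (\<lambda>t. t *s B2 (rep (x z)) (R (x z) u))) (at z)"
      by (simp add: has_cderiv_scale[OF B2[OF W2in]] has_cderiv_scale[OF R[OF x\<Omega>[OF z]]])
    have "\<forall>y\<in>\<Omega>. \<forall>A. has_cderiv rep A y \<Omega> \<longrightarrow> (\<forall>u\<in>L. \<forall>v\<in>L. herm D (rep y) (A u) (A v) = herm C y u v)"
      using f(3) CM DN unfolding preserves_metric_def \<Omega>_def rep_def modC(1)[symmetric] by blast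
    then have "herm D (rep (x z)) (R (x z) u) (R (x z) u) = herm C (x z) u u"
      using R[OF x\<Omega>[OF z]] x\<Omega>[OF z] u(1) by simp
    then show "herm c (\<beta> (x z)) (B (x z) u) (B (x z) u) =
        herm d (\<beta>2 (rep (x z))) (B2 (rep (x z)) (R (x z) u)) (B2 (rep (x z)) (R (x z) u))"
      by (simp add: C_def D slice_chart_def B_def B2_def Let_def)
  qed
  then show thesis by (rule that[OF c d])
qed

lemma holo_vec_affine_lift:
  assumes "\<And>z. z \<in> A \<Longrightarrow> (\<gamma> has_derivative (\<lambda>t. t *s \<gamma>' z)) (at z)"
  shows "holo_vec A (\<lambda>z. affine_lift j (\<gamma> z)) (\<lambda>z. affine_dir j (\<gamma>' z))"
  unfolding holo_vec_def
proof (intro ballI allI)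
  fix z l assume z: "z \<in> A"
  from bounded_linear.has_derivative[OF bounded_linear_vec_nth affine_lift_has_derivative[OF assms[OF z]], of j l]
  have "((\<lambda>z. affine_lift j (\<gamma> z) $ l) has_derivative (\<lambda>t. t * affine_dir j (\<gamma>' z) $ l)) (at z)"
    by (simp add: affine_dir_scale)
  then show "((\<lambda>z. affine_lift j (\<gamma> z) $ l) has_field_derivative affine_dir j (\<gamma>' z) $ l) (at z)"
    by (simp add: has_field_derivative_def mult_commute_abs)
qed

theorem theorem4p3:
  fixes a b :: real
  assumes "a \<noteq> 0" and "b \<noteq> 0"
    and "relatives (fubini_study b :: ('n::finite homogeneous set, 'n) atlas)
                   (fubini_study a :: ('m::finite homogeneous set, 'm) atlas)"
  shows "a * b > 0 \<and> a / b \<in> \<rat>"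
proof -
  have full: "model c = UNIV" if "c \<in> fubini_study b" for c :: "('n homogeneous set, 'n) hchart"
    using fubini_study_chart[OF that assms(2)] by blast
  have full': "model d = UNIV" if "d \<in> fubini_study a" for d :: "('m homogeneous set, 'm) hchart"
    using fubini_study_chart[OF that assms(1)] by blast
  obtain c :: "('n homogeneous set, 'n) hchart" and d :: "('m homogeneous set, 'm) hchart"
    and \<gamma> \<gamma>' \<delta> \<delta>' r where cd: "c \<in> fubini_study b" "d \<in> fubini_study a"
    and discs: "isometric_discs c d r \<gamma> \<gamma>' \<delta> \<delta>'"
    by (rule relatives_isometric_discs[OF assms(3) full full'])
  have r: "r > 0" and \<gamma>0: "\<gamma>' 0 \<noteq> 0"
    and dom: "\<And>z. z \<in> ball 0 r \<Longrightarrow> \<gamma> z \<in> pdom c" "\<And>z. z \<in> ball 0 r \<Longrightarrow> \<delta> z \<in> pdom d"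
    and der: "\<And>z. z \<in> ball 0 r \<Longrightarrow> (\<gamma> has_derivative (\<lambda>t. t *s \<gamma>' z)) (at z)"
      "\<And>z. z \<in> ball 0 r \<Longrightarrow> (\<delta> has_derivative (\<lambda>t. t *s \<delta>' z)) (at z)"
    and herm: "\<And>z. z \<in> ball 0 r \<Longrightarrow> herm c (\<gamma> z) (\<gamma>' z) (\<gamma>' z) = herm d (\<delta> z) (\<delta>' z) (\<delta>' z)"
    using discs by (simp_all add: isometric_discs_def)
  obtain j where j: "open (pdom c)" "herm c = potential_metric (projective_potential b j)" "b < 0 \<longrightarrow> j = None"
    "\<And>z. z \<in> pdom c \<Longrightarrow> Re (hform (fs_weight b) (affine_lift j z) (affine_lift j z)) > 0"
    using fubini_study_chart[OF cd(1) assms(2)] by blast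
  obtain i where i: "open (pdom d)" "herm d = potential_metric (projective_potential a i)"
    "\<And>z. z \<in> pdom d \<Longrightarrow> Re (hform (fs_weight a) (affine_lift i z) (affine_lift i z)) > 0"
    using fubini_study_chart[OF cd(2) assms(1)] by blast
  have 0: "(0::complex) \<in> ball 0 r" using r by simp
  have nz: "hform (fs_weight b) (affine_lift j (\<gamma> z)) (affine_lift j (\<gamma> z)) \<noteq> 0"
    "hform (fs_weight a) (affine_lift i (\<delta> z)) (affine_lift i (\<delta> z)) \<noteq> 0" if "z \<in> ball 0 r" for z
    using j(4)[OF dom(1)[OF that]] i(3)[OF dom(2)[OF that]] by auto
  have "\<exists>p q :: nat. q > 0 \<and> a / b = real p / real q"
  proof (rule exponent_of_isometric_discs[OF r holo_vec_affine_lift[OF der(1)] holo_vec_affine_lift[OF der(2)] assms(2)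
        nz(1)[OF 0] nz(2)[OF 0] _ hform_fs_nondegenerate[OF assms(2) j(3) \<gamma>0 j(4)[OF dom(1)[OF 0]]]])
    fix z :: complex assume z: "z \<in> ball 0 r"
    let ?V = "affine_lift j (\<gamma> z)" and ?V' = "affine_dir j (\<gamma>' z)" and ?f = "hform (fs_weight b)"
    let ?U = "affine_lift i (\<delta> z)" and ?U' = "affine_dir i (\<delta>' z)" and ?g = "hform (fs_weight a)"
    have "herm c (\<gamma> z) (\<gamma>' z) (\<gamma>' z) = (?f ?V' ?V' * ?f ?V ?V - ?f ?V' ?V * ?f ?V ?V') / (of_real b * (?f ?V ?V)\<^sup>2)"
      unfolding j(2) by (rule potential_metric_projective[OF assms(2) j(1) dom(1)[OF z] j(4)])
    moreover have "herm d (\<delta> z) (\<delta>' z) (\<delta>' z) = (?g ?U' ?U' * ?g ?U ?U - ?g ?U' ?U * ?g ?U ?U') / (of_real a * (?g ?U ?U)\<^sup>2)"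
      unfolding i(2) by (rule potential_metric_projective[OF assms(1) i(1) dom(2)[OF z] i(3)])
    ultimately have "(?f ?V' ?V' * ?f ?V ?V - ?f ?V' ?V * ?f ?V ?V') * (of_real a * (?g ?U ?U)\<^sup>2) =
        (?g ?U' ?U' * ?g ?U ?U - ?g ?U' ?U * ?g ?U ?U') * (of_real b * (?f ?V ?V)\<^sup>2)"
      using herm[OF z] nz[OF z] assms(1,2) by (simp add: frac_eq_eq)
    then show "of_real a * (?f ?V' ?V' * ?f ?V ?V - ?f ?V' ?V * ?f ?V ?V') * (?g ?U ?U)\<^sup>2 =
        of_real b * (?g ?U' ?U' * ?g ?U ?U - ?g ?U' ?U * ?g ?U ?U') * (?f ?V ?V)\<^sup>2"
      by (simp only: mult_ac)
  qed
  then obtain p q :: nat where pq: "q > 0" "a / b = real p / real q" by blast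
  have "a / b \<ge> 0" using pq by simp
  \<comment> \<open>The order \<open>p\<close> could be \<open>0\<close> in the quotient;
    \<open>a \<noteq> 0\<close> excludes this and makes the sign strict.\<close>
  moreover have "a / b \<noteq> 0" using assms by simp
  ultimately have "a * b > 0" by (simp add: zero_le_divide_iff zero_less_mult_iff) (use assms in linarith)
  moreover have "a / b \<in> \<rat>" unfolding pq(2) by (intro Rats_divide Rats_of_nat)
  ultimately show ?thesis by blast
qed

end
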